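(* Let $G$ be a finite subgroup of the additive group $\mathbb{K}^+$ of a field $\mathbb{K}$, and let $\mathcal{C}^G_+$ be the smallest class of loopless gain graphs with gain group $G$ satisfying: (i) the null graph belongs to $\mathcal{C}^G_+$; (ii) if $\Gamma$ has a link-simplicial vertex $v$ and $\Gamma\setminus v\in\mathcal{C}^G_+$, then $\Gamma\in\mathcal{C}^G_+$; (iii) if $V_\Gamma=V_1\cup V_2$ with $\Gamma[V_1],\Gamma[V_2]\in\mathcal{C}^G_+$, $E_\Gamma=E_{\Gamma[V_1]}\cup E_{\Gamma[V_2]}$, and $\Gamma[V_1\cap V_2]\simeq K_n^G$ for some $n$, then $\Gamma\in\mathcal{C}^G_+$. Then for every $\Gamma\in\mathcal{C}^G_+$ the arrangement $\mathcal{A}_+(\Gamma)$ is divisionally free.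
   Context: A loopless gain graph $\Gamma=(V_\Gamma,E_\Gamma,G_\Gamma)$ consists of a finite vertex set, a group $G_\Gamma$ (here written additively), and a finite set $E_\Gamma$ of edges $\{u,v\}_g$ (classes of triples $(u,v,g)$, $u\ne v$, $g\in G_\Gamma$, with $(u,v,g)\sim(v,u,-g)$). $\Gamma[W]$ is the induced subgraph on $W$ and $\Gamma\setminus v=\Gamma[V_\Gamma\setminus\{v\}]$. $K_n^G$ is the loopless gain graph on $[n]$ with all edges $\{i,j\}_g$ ($i\ne j$, $g\in G$); thus $\Gamma[V_1\cap V_2]\simeq K_n^G$ means all edges $\{u,v\}_g$ with $u\ne v$ in $V_1\cap V_2$ and $g\in G$ are present. A vertex $v$ is link simplicial if whenever $\{u,v\}_g,\{v,w\}_h\in E_\Gamma$ with $u\ne w$, then $\{u,w\}_{g+h}\in E_\Gamma$. For $\Gamma$ with vertex set $[N]$ (after labeling) and gain group $G\le\mathbb{K}^+$, $\mathcal{A}_+(\Gamma)$ is the arrangement in $\mathbb{K}^{N+1}$ with coordinates $z,x_1,\dots,x_N$ consisting of $\{z=0\}$ and the hyperplanes $\{x_i-x_j=gz\}$ for $\{i,j\}_g\in E_\Gamma$. For a simple matroid $M$ on $E$ with rank function $r$ and lattice of flats $L(M)$, $\chi(M,t)=\sum_{X\in L(M)}\mu(X)t^{r(E)-r(X)}$ ($\mu$ the Möbius function from the bottom), computed for contractions from their lattice of flats. A divisional flag of $M$ of rank $n$ is a chain of flats $\varnothing=X_0\subseteq\dots\subseteq X_n=E$ with $r(X_i)=i$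 and $\chi(M/X_{i+1},t)\mid\chi(M/X_i,t)$. The linear dependence matroid $M(\mathcal{A})$ of a central arrangement $\mathcal{A}$ is the matroid on $\mathcal{A}$ where $\{H_1,\dots,H_k\}$ is independent iff $\operatorname{codim}(H_1\cap\dots\cap H_k)=k$; $\mathcal{A}$ is divisionally free if $M(\mathcal{A})$ has a divisional flag. *)

theory Defs
  imports
    Complex_Main
    "HOL-Library.Function_Algebras"
    "HOL-Computational_Algebra.Polynomial"
begin

section \<open>Gain graphs\<close>

text \<open>The gain group is a subgroup of an ambient additive group, which is not assumed commutative.\<close>

definition additive_subgroup :: "'g::group_add set \<Rightarrow> bool" where
  "additive_subgroup G \<longleftrightarrow> 0 \<in> G \<and> (\<forall>a\<in>G. \<forall>b\<in>G. a + b \<in> G) \<and> (\<forall>a\<in>G. - a \<in> G)"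

text \<open>\<open>gain_edge u v g\<close> is the edge $\{u,v\}_g$, i.e. the class of $(u,v,g)$ modulo
  $(u,v,g) \sim (v,u,-g)$.\<close>

definition gain_edge :: "'v \<Rightarrow> 'v \<Rightarrow> 'g::group_add \<Rightarrow> ('v \<times> 'v \<times> 'g) set" where
  "gain_edge u v g = {(u, v, g), (v, u, - g)}"

record ('v, 'g) gain_graph =
  verts :: "'v set"
  edges :: "('v \<times> 'v \<times> 'g) set set"
  gains :: "'g set"

definition complete_gain_graph :: "'g::group_add set \<Rightarrow> 'v set \<Rightarrow> ('v, 'g) gain_graph" where
  "complete_gain_graph G W =
    \<lparr>verts = W, edges = {gain_edge u v g | u v g. u \<in> W \<and> v \<in> W \<and> u \<noteq> v \<and> g \<in> G}, gains = G\<rparr>"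

definition loopless_gain_graph :: "('v, 'g::group_add) gain_graph \<Rightarrow> bool" where
  "loopless_gain_graph \<Gamma> \<longleftrightarrow>
    finite (verts \<Gamma>) \<and> additive_subgroup (gains \<Gamma>) \<and> finite (edges \<Gamma>) \<and>
    edges \<Gamma> \<subseteq> edges (complete_gain_graph (gains \<Gamma>) (verts \<Gamma>))"

definition null_gain_graph :: "'g set \<Rightarrow> ('v, 'g) gain_graph" where
  "null_gain_graph G = \<lparr>verts = {}, edges = {}, gains = G\<rparr>"

definition induced :: "('v, 'g::group_add) gain_graph \<Rightarrow> 'v set \<Rightarrow> ('v, 'g) gain_graph" where
  "induced \<Gamma> W =
    \<lparr>verts = W, edges = {e \<in> edges \<Gamma>. \<exists>u\<in>W. \<exists>v\<in>W. \<exists>g. e = gain_edge u v g}, gains = gains \<Gamma>\<rparr>"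

definition delete_vertex :: "('v, 'g::group_add) gain_graph \<Rightarrow> 'v \<Rightarrow> ('v, 'g) gain_graph" where
  "delete_vertex \<Gamma> v = induced \<Gamma> (verts \<Gamma> - {v})"

definition link_simplicial :: "('v, 'g::group_add) gain_graph \<Rightarrow> 'v \<Rightarrow> bool" where
  "link_simplicial \<Gamma> v \<longleftrightarrow> v \<in> verts \<Gamma> \<and>
    (\<forall>u w g h. gain_edge u v g \<in> edges \<Gamma> \<longrightarrow> gain_edge v w h \<in> edges \<Gamma> \<longrightarrow> u \<noteq> w \<longrightarrow>
      gain_edge u w (g + h) \<in> edges \<Gamma>)"

text \<open>The class $\mathcal{C}^G_+$. In the gluing rule, an induced subgraph on $W$ that is isomorphic
  to some $K_n^G$ is one that contains all edges on $W$ with gains in $G$. The case $n = 0$, in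
  which the two parts are disjoint, is included.\<close>

inductive gain_class :: "'g::group_add set \<Rightarrow> ('v, 'g) gain_graph \<Rightarrow> bool" for G where
  null: "gain_class G (null_gain_graph G)"
| simplicial:
    "\<lbrakk>loopless_gain_graph \<Gamma>; gains \<Gamma> = G; link_simplicial \<Gamma> v; gain_class G (delete_vertex \<Gamma> v)\<rbrakk>
      \<Longrightarrow> gain_class G \<Gamma>"
| glue:
    "\<lbrakk>loopless_gain_graph \<Gamma>; gains \<Gamma> = G; verts \<Gamma> = V1 \<union> V2;
      gain_class G (induced \<Gamma> V1); gain_class G (induced \<Gamma> V2);
      edges \<Gamma> = edges (induced \<Gamma> V1) \<union> edges (induced \<Gamma> V2);
      induced \<Gamma> (V1 \<inter> V2) = complete_gain_graph G (V1 \<inter> V2)\<rbrakk>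
      \<Longrightarrow> gain_class G \<Gamma>"


section \<open>Matroids and divisional flags\<close>

text \<open>Matroids are given by their ground set and independent sets. The record does not carry the
  matroid axioms; the notions below are the standard ones for finite matroids.\<close>

record 'a indep_system =
  ground :: "'a set"
  indep :: "'a set \<Rightarrow> bool"

definition rank :: "'a indep_system \<Rightarrow> 'a set \<Rightarrow> nat" where
  "rank M X = Max (card ` {I. I \<subseteq> X \<and> indep M I})"

definition flats :: "'a indep_system \<Rightarrow> 'a set set" where
  "flats M = {X. X \<subseteq> ground M \<and> (\<forall>e \<in> ground M - X. rank M X < rank M (insert e X))}"

text \<open>No simplification takes place in a contraction, so it may have parallel elements.\<close>

definition contract :: "'a indep_system \<Rightarrow> 'a set \<Rightarrow> 'a indep_system" where
  "contract M X =
    \<lparr>ground = ground M - X,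
     indep = (\<lambda>I. I \<subseteq> ground M - X \<and> rank M (I \<union> X) = card I + rank M X)\<rparr>"

text \<open>The Moebius function of a family of sets ordered by inclusion. Infinite sets, which do not
  occur below, receive a junk value to make the recursion terminate.\<close>

function mobius :: "'a set set \<Rightarrow> 'a set \<Rightarrow> 'a set \<Rightarrow> int" where
  "mobius L X Y =
    (if infinite Y then 0
     else if X = Y then 1
     else - (\<Sum>Z \<in> {Z \<in> L. X \<subseteq> Z \<and> Z \<subset> Y}. mobius L X Z))"
  by pat_completeness auto
termination
  by (relation "measure (\<lambda>(L, X, Y). card Y)") (auto intro: psubset_card_mono)

declare mobius.simps [simp del]

text \<open>The intersection of all flats is the least flat.\<close>

definition char_poly :: "'a indep_system \<Rightarrow> int poly" where
  "char_poly M =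
    (\<Sum>X \<in> flats M.
      monom (mobius (flats M) (\<Inter>(flats M)) X) (rank M (ground M) - rank M X))"

definition divisional_flag :: "'a indep_system \<Rightarrow> (nat \<Rightarrow> 'a set) \<Rightarrow> bool" where
  "divisional_flag M X \<longleftrightarrow>
    (let n = rank M (ground M) in
      X 0 = {} \<and> X n = ground M \<and>
      (\<forall>i\<le>n. X i \<in> flats M \<and> rank M (X i) = i) \<and>
      (\<forall>i<n. X i \<subseteq> X (Suc i) \<and>
        char_poly (contract M (X (Suc i))) dvd char_poly (contract M (X i))))"


section \<open>Arrangements\<close>

text \<open>Coordinate vectors are functions on the natural numbers; $\mathbb{K}^n$ consists of those
  supported on $\{0, \dots, n-1\}$.\<close>

definition vscale :: "'k::field \<Rightarrow> (nat \<Rightarrow> 'k) \<Rightarrow> nat \<Rightarrow> 'k" where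
  "vscale c x = (\<lambda>i. c * x i)"

interpretation coord: vector_space vscale
  by unfold_locales (auto simp: vscale_def fun_eq_iff algebra_simps)

definition coord_space :: "nat \<Rightarrow> (nat \<Rightarrow> 'k::field) set" where
  "coord_space n = {x. \<forall>i\<ge>n. x i = 0}"

definition codim :: "nat \<Rightarrow> (nat \<Rightarrow> 'k::field) set \<Rightarrow> nat" where
  "codim n U = coord.dim (coord_space n :: (nat \<Rightarrow> 'k) set) - coord.dim U"

text \<open>An arrangement in $\mathbb{K}^n$ is a set of hyperplanes, each a subset of
  \<open>coord_space n\<close>. Intersecting with \<open>coord_space n\<close> only matters for the empty family, whose
  intersection is the whole space.\<close>

definition dependence_matroid ::
    "nat \<Rightarrow> (nat \<Rightarrow> 'k::field) set set \<Rightarrow> (nat \<Rightarrow> 'k) set indep_system" where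
  "dependence_matroid n A =
    \<lparr>ground = A,
     indep = (\<lambda>S. S \<subseteq> A \<and> finite S \<and> codim n (coord_space n \<inter> \<Inter>S) = card S)\<rparr>"

definition divisionally_free :: "nat \<Rightarrow> (nat \<Rightarrow> 'k::field) set set \<Rightarrow> bool" where
  "divisionally_free n A \<longleftrightarrow> (\<exists>X. divisional_flag (dependence_matroid n A) X)"

text \<open>A labeling numbers the \<open>N\<close> vertices by \<open>1, \<dots>, N\<close>. Coordinate \<open>0\<close> is $z$, and
  coordinate \<open>i\<close> with \<open>1 \<le> i \<le> N\<close> is $x_i$.\<close>

definition labeling :: "('v, 'g) gain_graph \<Rightarrow> ('v \<Rightarrow> nat) \<Rightarrow> bool" where
  "labeling \<Gamma> l \<longleftrightarrow> bij_betw l (verts \<Gamma>) {1..card (verts \<Gamma>)}"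

definition ambient_dim :: "('v, 'g) gain_graph \<Rightarrow> nat" where
  "ambient_dim \<Gamma> = card (verts \<Gamma>) + 1"

definition gain_arrangement ::
    "('v \<Rightarrow> nat) \<Rightarrow> ('v, 'k::field) gain_graph \<Rightarrow> (nat \<Rightarrow> 'k) set set" where
  "gain_arrangement l \<Gamma> =
    insert {x \<in> coord_space (ambient_dim \<Gamma>). x 0 = 0}
      {{x \<in> coord_space (ambient_dim \<Gamma>). x (l u) - x (l v) = g * x 0} | u v g.
        gain_edge u v g \<in> edges \<Gamma>}"

end

theory Submission
  imports Defs
begin

text \<open>Call a set \<open>W\<close> of vertices full if every edge inside \<open>W\<close> with gain in \<open>G\<close> is present. In terms of
  the vectors $e_u - e_v - g e_0$, the flat of a full set \<open>W\<close> is modular: a combination of edges that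
  is supported on \<open>W\<close> and on coordinate \<open>0\<close> vanishes, unless the edges span $z$ or an edge inside
  \<open>W\<close>. By induction over the class one shows, for every full \<open>W\<close>, that there is a chain of flats
  disjoint from \<open>W\<close>, complementary to \<open>W\<close> at its end, along which the characteristic polynomials of
  the contractions divide each other. For a gluing, Stanley's modular factorization carries the chain
  of one part over to the whole graph, and it ends in a contraction to the other part, whose own chain
  continues it. For a link-simplicial vertex \<open>v\<close>, contracting an edge at \<open>v\<close> gives the graph without
  \<open>v\<close>, up to parallel elements; when \<open>v \<in> W\<close>, a neighbour outside \<open>W\<close> takes the place of \<open>v\<close>.
  The theorem is the case $W = \emptyset$, where the chain is complementary to the flat $\{z\}$.\<close>

text \<open>Gluing forces the induction to treat all full sets \<open>W\<close>: the chain of one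
  part has to end complementary to the intersection of the two parts, which is full. Flats that
  avoid a modular \<open>W\<close> span nothing in it, so they have the same modular factor in the
  part and in the whole graph. No quotient is computed. The two factorizations give a
  cross-multiplied identity, from which the nonzero polynomial of the intersection is cancelled. The
  obstacle is a link-simplicial vertex \<open>v\<close> inside \<open>W\<close>, because
  \<open>W\<close> does not survive the deletion of \<open>v\<close>. Modulo an edge from
  \<open>v\<close> to \<open>u\<close>, however, \<open>W\<close> spans the same as the set with
  \<open>u\<close> in place of \<open>v\<close>, so a chain that starts with this edge serves both
  sets. Characteristic polynomials are treated as alternating sums over subsets. There parallel
  elements cancel in pairs and no contraction has to be simplified; lattices of flats enter only in
  the translation to \<open>char_poly\<close>.\<close>

text \<open>Toggling \<open>x\<close> is a sign-reversing involution on the subsets of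
  \<open>T\<close>. In the cancellations for \<open>chi\<close>, \<open>f\<close> records a rank and
  \<open>x\<close> is spanned by elements that every term contains.\<close>

lemma sum_alternating_Pow_toggle:
  fixes f :: "'a set \<Rightarrow> 'b::comm_ring_1"
  assumes "finite T" "x \<in> T" "\<And>C. C \<subseteq> T - {x} \<Longrightarrow> f (insert x C) = f C"
  shows "(\<Sum>C\<in>Pow T. (-1) ^ card C * f C) = 0"
proof -
  let ?g = "\<lambda>C. (-1) ^ card C * f C"
  have T: "T = insert x (T - {x})" using assms(2) by auto
  have "(\<Sum>C\<in>Pow T. ?g C) = (\<Sum>C\<in>Pow (insert x (T - {x})). ?g C)"
    using T by simp
  also have "\<dots> = (\<Sum>C\<in>Pow (T - {x}). ?g C) + (\<Sum>C\<in>insert x ` Pow (T - {x}). ?g C)"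
    unfolding Pow_insert using assms(1) by (intro sum.union_disjoint) auto
  also have "(\<Sum>C\<in>insert x ` Pow (T - {x}). ?g C) = (\<Sum>C\<in>Pow (T - {x}). ?g (insert x C))"
    by (intro sum.reindex_cong[of "insert x"] inj_onI) auto
  also have "\<dots> = (\<Sum>C\<in>Pow (T - {x}). - ?g C)"
  proof (intro sum.cong refl)
    fix C assume "C \<in> Pow (T - {x})"
    hence C: "C \<subseteq> T - {x}" by simp
    hence "finite C" "x \<notin> C" using assms(1) finite_subset by auto
    thus "?g (insert x C) = - ?g C" using assms(3)[OF C] by simp
  qed
  finally show ?thesis by (simp add: sum_negf)
qed

lemma sum_Pow_Un:
  assumes "finite A" "finite B" "A \<inter> B = {}"
  shows "(\<Sum>S\<in>Pow (A \<union> B). f S) = (\<Sum>S\<in>Pow A. \<Sum>T\<in>Pow B. f (S \<union> T))"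
proof -
  have "(\<Sum>S\<in>Pow A. \<Sum>T\<in>Pow B. f (S \<union> T)) = (\<Sum>(S, T)\<in>Pow A \<times> Pow B. f (S \<union> T))"
    using assms by (simp add: sum.cartesian_product)
  also have "\<dots> = (\<Sum>S\<in>Pow (A \<union> B). f S)"
    using assms(3)
    by (intro sum.reindex_bij_witness[of _ "\<lambda>S. (S \<inter> A, S \<inter> B)" "\<lambda>(S, T). S \<union> T"])
      (auto simp: Int_Un_distrib2 intro!: arg_cong[of _ _ f])
  finally show ?thesis by simp
qed

section \<open>Rank functions and divisional chains\<close>

text \<open>Matroid rank axioms in local form: unit increase, and what is redundant over a set stays
  redundant over larger ones. There is no ground set, since the ranks of several grounds are
  compared. The instances are dimensions of sets of vectors, contractions, and sets of
  hyperplanes.\<close>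

locale rank_function =
  fixes r :: "'a set \<Rightarrow> nat"
  assumes rank_empty [simp]: "r {} = 0"
    and rank_insert_cases: "finite S \<Longrightarrow> r (insert e S) = r S \<or> r (insert e S) = Suc (r S)"
    and rank_insert_mono:
      "finite T \<Longrightarrow> S \<subseteq> T \<Longrightarrow> r (insert e S) = r S \<Longrightarrow> r (insert e T) = r T"
begin

definition spans :: "'a set \<Rightarrow> 'a \<Rightarrow> bool" where
  "spans S e \<longleftrightarrow> r (insert e S) = r S"

lemma spans_mono: "finite T \<Longrightarrow> S \<subseteq> T \<Longrightarrow> spans S e \<Longrightarrow> spans T e"
  unfolding spans_def by (rule rank_insert_mono)

lemma spans_mem: "e \<in> S \<Longrightarrow> spans S e"
  by (simp add: spans_def insert_absorb)

lemma rank_insert_not_spans: "finite S \<Longrightarrow> \<not> spans S e \<Longrightarrow> r (insert e S) = Suc (r S)"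
  unfolding spans_def using rank_insert_cases by blast

lemma rank_Un_spans:
  assumes "finite S" "finite U" "\<And>u. u \<in> U \<Longrightarrow> spans S u"
  shows "r (S \<union> U) = r S"
  using assms(2,3)
proof (induction U)
  case (insert u U)
  have "spans (S \<union> U) u"
    using insert assms(1) by (intro spans_mono[of "S \<union> U" S]) auto
  thus ?case using insert by (simp add: spans_def)
qed simp

lemma rank_mono: "finite T \<Longrightarrow> S \<subseteq> T \<Longrightarrow> r S \<le> r T"
proof -
  assume "finite T" "S \<subseteq> T"
  have "r S \<le> r (S \<union> U)" if "finite U" for U
    using that
  proof (induction U)
    case (insert u U)
    have "finite (S \<union> U)" using insert \<open>finite T\<close> \<open>S \<subseteq> T\<close> finite_subset by auto
    from rank_insert_cases[OF this, of u] insert show ?case by auto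
  qed simp
  from this[of T] show ?thesis using \<open>finite T\<close> \<open>S \<subseteq> T\<close> by (simp add: Un_absorb1)
qed

lemma spans_trans:
  assumes "finite S" "finite U" "\<And>u. u \<in> U \<Longrightarrow> spans S u" "spans U e"
  shows "spans S e"
proof -
  have "spans (S \<union> U) e" using assms by (intro spans_mono[of "S \<union> U" U]) auto
  hence "r (insert e (S \<union> U)) = r S" using rank_Un_spans[OF assms(1-3)] by (simp add: spans_def)
  moreover have "r (insert e S) \<le> r (insert e (S \<union> U))" using assms by (intro rank_mono) auto
  moreover have "r S \<le> r (insert e S)" using assms by (intro rank_mono) auto
  ultimately show ?thesis by (simp add: spans_def)
qed

lemma spans_exchange:
  assumes "finite S" "spans (insert x S) e" "\<not> spans S e"
  shows "spans (insert e S) x"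
proof -
  have "r (insert x (insert e S)) = r (insert x S)"
    using assms(2) by (simp add: spans_def insert_commute)
  also have "\<dots> \<le> Suc (r S)" using rank_insert_cases[OF assms(1), of x] by auto
  also have "\<dots> = r (insert e S)" using rank_insert_not_spans[OF assms(1,3)] by simp
  finally have "r (insert x (insert e S)) \<le> r (insert e S)" .
  moreover have "r (insert e S) \<le> r (insert x (insert e S))" using assms by (intro rank_mono) auto
  ultimately show ?thesis by (simp add: spans_def)
qed

lemma rank_eq_of_spans:
  assumes "finite S" "finite U" "\<And>u. u \<in> U \<Longrightarrow> spans S u" "\<And>s. s \<in> S \<Longrightarrow> spans U s"
  shows "r S = r U"
  using rank_Un_spans[of S U] rank_Un_spans[of U S] assms by (simp add: Un_commute)

lemma spans_of_rank_eq:
  assumes "finite T" "S \<subseteq> T" "r S = r T" "e \<in> T"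
  shows "spans S e"
proof -
  have "finite S" using assms finite_subset by blast
  have "r (insert e S) \<le> r T" using assms by (intro rank_mono) auto
  moreover have "r S \<le> r (insert e S)" using \<open>finite S\<close> by (intro rank_mono) auto
  ultimately show ?thesis using assms by (simp add: spans_def)
qed

text \<open>The elements of \<open>T\<close> are added one at a time. By hypothesis \<open>S\<close>
  makes none of them newly redundant, so both sides grow alike.\<close>

lemma rank_Un_skew:
  assumes "finite S" "finite T"
    "\<And>U e. U \<subseteq> T \<Longrightarrow> e \<in> T \<Longrightarrow> spans (S \<union> U) e \<Longrightarrow> spans U e"
  shows "r (S \<union> T) = r S + r T"
  using assms(2,3)
proof (induction T)
  case (insert t T)
  have IH: "r (S \<union> T) = r S + r T" using insert.prems by (intro insert.IH) blast
  have fin: "finite (S \<union> T)" using assms(1) insert.hyps by simp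
  show ?case
  proof (cases "spans T t")
    case True
    hence "spans (S \<union> T) t" using fin by (intro spans_mono[of "S \<union> T" T]) auto
    thus ?thesis using True IH by (simp add: spans_def)
  next
    case False
    hence "\<not> spans (S \<union> T) t" using insert.prems[of T t] by blast
    thus ?thesis using rank_insert_not_spans[OF fin] rank_insert_not_spans[OF insert.hyps(1) False] IH
      by simp
  qed
qed simp

lemma rank_function_contract:
  assumes "finite X"
  shows "rank_function (\<lambda>S. r (S \<union> X) - r X)"
proof
  fix S :: "'a set" and e assume "finite S"
  hence "r X \<le> r (S \<union> X)" using assms by (intro rank_mono) auto
  thus "r (insert e S \<union> X) - r X = r (S \<union> X) - r X \<or>
      r (insert e S \<union> X) - r X = Suc (r (S \<union> X) - r X)"
    using rank_insert_cases[of "S \<union> X" e] \<open>finite S\<close> assms by auto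
next
  fix S T :: "'a set" and e
  assume *: "finite T" "S \<subseteq> T" "r (insert e S \<union> X) - r X = r (S \<union> X) - r X"
  have "finite S" using * finite_subset by blast
  hence "r X \<le> r (S \<union> X)" "r X \<le> r (insert e S \<union> X)" using assms by (auto intro!: rank_mono)
  hence "r (insert e (S \<union> X)) = r (S \<union> X)" using * by simp
  hence "r (insert e (T \<union> X)) = r (T \<union> X)"
    using rank_insert_mono[of "T \<union> X" "S \<union> X" e] * assms by auto
  thus "r (insert e T \<union> X) - r X = r (T \<union> X) - r X" by simp
qed simp

section \<open>Characteristic polynomials as subset expansions\<close>

text \<open>Whitney's subset expansion of the characteristic polynomial of the contraction of
  \<open>E\<close> by \<open>F\<close>; for closed \<open>F\<close> see
  \<open>char_poly_contract\<close>. Unlike the sum over flats, it can be manipulated one element at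
  a time.\<close>

definition chi :: "'a set \<Rightarrow> 'a set \<Rightarrow> int poly" where
  "chi E F = (\<Sum>S\<in>Pow (E - F). monom ((-1) ^ card S) (r E - r (S \<union> F)))"

lemma monom_sign: "monom ((-1) ^ k) n = (-1) ^ k * monom (1::int) n"
  by (cases "even k") (auto simp: minus_monom)

lemma monom_sign_add: "monom ((-1) ^ (a + b)) n = (-1) ^ a * ((-1) ^ b * monom (1::int) n)"
  unfolding monom_sign by (simp add: power_add mult.assoc)

lemma monom_sum: "monom (sum f A) n = (\<Sum>a\<in>A. monom (f a) n)"
  by (simp add: poly_eq_iff coeff_sum)

lemma chi_ground: "chi E E = 1"
  by (simp add: chi_def)

text \<open>Only the empty set contributes in degree \<open>r X\<close>, since every other subset
  has positive rank. This permits the cancellation in \<open>divisional_chain_glue\<close>.\<close>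

lemma chi_nonzero:
  assumes "finite X" "\<And>e. e \<in> X \<Longrightarrow> r {e} = 1"
  shows "chi X {} \<noteq> 0"
proof -
  have "coeff (chi X {}) (r X) = (\<Sum>S\<in>Pow X. if S = {} then 1 else 0)"
    unfolding chi_def coeff_sum Diff_empty
  proof (intro sum.cong refl)
    fix S assume "S \<in> Pow X"
    hence S: "S \<subseteq> X" "finite S" using assms finite_subset by auto
    show "coeff (monom ((- 1) ^ card S) (r X - r (S \<union> {}))) (r X) = (if S = {} then 1 else (0::int))"
    proof (cases "S = {}")
      case False
      then obtain e where e: "e \<in> S" by auto
      hence "r {e} \<le> r S" "r S \<le> r X" using S assms by (auto intro!: rank_mono)
      moreover have "r {e} = 1" using e S assms by auto
      ultimately show ?thesis using False by simp
    qed simp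
  qed
  also have "\<dots> = 1" using assms(1) by simp
  finally show ?thesis by auto
qed

text \<open>With \<open>X = Y\<close> and \<open>A\<close> the complement of \<open>X\<close>, this says that the flat \<open>X\<close> is modular.\<close>

definition modular_over :: "'a set \<Rightarrow> 'a set \<Rightarrow> 'a set \<Rightarrow> bool" where
  "modular_over A Y X \<longleftrightarrow>
    (\<forall>S\<subseteq>A. (\<exists>x\<in>X. spans S x) \<or> (\<forall>T\<subseteq>Y. r (S \<union> T) = r S + r T))"

lemma modular_over_mono:
  "modular_over A Y X \<Longrightarrow> Y' \<subseteq> Y \<Longrightarrow> X \<subseteq> X' \<Longrightarrow> modular_over A Y' X'"
  unfolding modular_over_def by (meson subset_iff)

text \<open>The cofactor in Stanley's theorem: the subset expansion restricted to those sets that,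
  together with \<open>F\<close>, span no element of \<open>X\<close>. The corank \<open>d\<close>
  is passed as a number so that the same term serves the grounds \<open>A \<union> X\<close> and
  \<open>A \<union> Y\<close>.\<close>

definition modular_factor :: "'a set \<Rightarrow> 'a set \<Rightarrow> 'a set \<Rightarrow> nat \<Rightarrow> int poly" where
  "modular_factor A X F d =
    (\<Sum>S\<in>{S \<in> Pow (A - F). \<forall>x\<in>X. \<not> spans (S \<union> F) x}. monom ((-1) ^ card S) (d - r (S \<union> F)))"

text \<open>Stanley's modular factorization. A set outside \<open>Y\<close> that spans some \<open>x \<in> X\<close> contributes nothing,
  because toggling \<open>x\<close> reverses the sign without changing the rank. The factor does not depend on
  \<open>Y\<close>.\<close>

lemma chi_modular_factor:
  assumes fin: "finite A" "finite Y" and AY: "A \<inter> Y = {}" and XY: "X \<subseteq> Y" and FA: "F \<subseteq> A"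
    and mod: "modular_over A Y X" and d: "r (A \<union> Y) = r Y + d"
  shows "chi (A \<union> Y) F = modular_factor A X F d * chi Y {}"
proof -
  let ?good = "\<lambda>S. \<forall>x\<in>X. \<not> spans (S \<union> F) x"
  let ?m = "\<lambda>S T. monom ((-1) ^ card (S \<union> T)) (r (A \<union> Y) - r (S \<union> T \<union> F)) :: int poly"
  have finF: "finite F" using FA fin finite_subset by blast
  have split: "A \<union> Y - F = (A - F) \<union> Y" using AY FA by auto
  have "chi (A \<union> Y) F = (\<Sum>S\<in>Pow (A - F). \<Sum>T\<in>Pow Y. ?m S T)"
    unfolding chi_def split using fin AY by (intro sum_Pow_Un) auto
  also have "\<dots> = (\<Sum>S\<in>Pow (A - F).
      if ?good S then monom ((-1) ^ card S) (d - r (S \<union> F)) * chi Y {} else 0)"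
  proof (intro sum.cong refl)
    fix S assume "S \<in> Pow (A - F)"
    hence S: "S \<subseteq> A - F" "S \<union> F \<subseteq> A" using FA by auto
    hence "finite S" using fin finite_subset by (meson Diff_subset subset_trans)
    have card: "card (S \<union> T) = card S + card T" if "T \<subseteq> Y" for T
      using that S \<open>finite S\<close> AY fin finite_subset by (intro card_Un_disjoint) auto
    show "(\<Sum>T\<in>Pow Y. ?m S T) =
        (if ?good S then monom ((-1) ^ card S) (d - r (S \<union> F)) * chi Y {} else 0)"
    proof (cases "?good S")
      case True
      have sk: "r (S \<union> F \<union> T) = r (S \<union> F) + r T" if "T \<subseteq> Y" for T
        using mod S(2) True that unfolding modular_over_def by blast
      have "r (S \<union> F \<union> Y) \<le> r (A \<union> Y)" using fin S by (intro rank_mono) auto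
      \<comment> \<open>The exponents are truncated differences; this bound makes them add
        up.\<close>
      hence le: "r (S \<union> F) \<le> d" using sk[of Y] d by simp
      have "?m S T = monom ((-1) ^ card S) (d - r (S \<union> F)) * monom ((-1) ^ card T) (r Y - r T)"
        if "T \<in> Pow Y" for T
      proof -
        have T: "T \<subseteq> Y" using that by simp
        have "r T \<le> r Y" using T fin by (intro rank_mono) auto
        hence "r (A \<union> Y) - r (S \<union> T \<union> F) = (d - r (S \<union> F)) + (r Y - r T)"
          using sk[OF T] d le by (simp add: Un_ac)
        thus ?thesis using card[OF T] by (simp add: mult_monom power_add)
      qed
      thus ?thesis using True by (simp add: chi_def sum_distrib_left)
    next
      case False
      then obtain x where x: "x \<in> X" "spans (S \<union> F) x" by auto
      have eq: "?m S T = (-1) ^ card S * ((-1) ^ card T * monom 1 (r (A \<union> Y) - r (S \<union> T \<union> F)))"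
        if "T \<in> Pow Y" for T
        using card[of T] that by (simp add: monom_sign_add)
      have "(\<Sum>T\<in>Pow Y. (-1) ^ card T * monom (1::int) (r (A \<union> Y) - r (S \<union> T \<union> F))) = 0"
      proof (rule sum_alternating_Pow_toggle[OF fin(2), of x])
        show "x \<in> Y" using x XY by auto
      next
        fix C assume "C \<subseteq> Y - {x}"
        hence "finite C" using fin finite_subset by blast
        hence "spans (S \<union> C \<union> F) x" using x \<open>finite S\<close> finF by (intro spans_mono[OF _ _ x(2)]) auto
        thus "monom (1::int) (r (A \<union> Y) - r (S \<union> insert x C \<union> F)) =
            monom 1 (r (A \<union> Y) - r (S \<union> C \<union> F))"
          by (simp add: spans_def)
      qed
      hence "(\<Sum>T\<in>Pow Y. ?m S T) = 0"
        using eq by (simp add: sum_distrib_left[symmetric])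
      thus ?thesis using False by (simp del: ball_simps)
    qed
  qed
  also have "\<dots> = (\<Sum>S\<in>{S \<in> Pow (A - F). ?good S}. monom ((-1) ^ card S) (d - r (S \<union> F)) * chi Y {})"
    using fin by (intro sum.inter_filter[symmetric]) auto
  also have "\<dots> = modular_factor A X F d * chi Y {}"
    unfolding modular_factor_def by (simp only: sum_distrib_right)
  finally show ?thesis .
qed

definition closed_in :: "'a set \<Rightarrow> 'a set \<Rightarrow> bool" where
  "closed_in E F \<longleftrightarrow> F \<subseteq> E \<and> (\<forall>e\<in>E. spans F e \<longrightarrow> e \<in> F)"

definition closure_in :: "'a set \<Rightarrow> 'a set \<Rightarrow> 'a set" where
  "closure_in E F = {e \<in> E. spans F e}"

lemma rank_closure_in_Un:
  assumes "finite E" "finite T" "F \<subseteq> E"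
  shows "r (closure_in E F \<union> T) = r (F \<union> T)"
proof (rule rank_eq_of_spans)
  have "finite F" "finite (closure_in E F)"
    using assms finite_subset by (auto simp: closure_in_def)
  thus fin: "finite (F \<union> T)" "finite (closure_in E F \<union> T)" using assms by auto
  fix e assume "e \<in> closure_in E F \<union> T"
  thus "spans (F \<union> T) e"
    using spans_mono[of "F \<union> T" F e] fin by (auto simp: closure_in_def intro: spans_mem)
next
  fix e assume "e \<in> F \<union> T"
  thus "spans (closure_in E F \<union> T) e"
    using assms by (intro spans_mem) (auto simp: closure_in_def intro: spans_mem)
qed

lemma closed_in_closure_in:
  assumes "finite E" "F \<subseteq> E"
  shows "closed_in E (closure_in E F)"
  unfolding closed_in_def
proof safe
  fix e assume e: "e \<in> E" "spans (closure_in E F) e"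
  have "finite F" "finite (closure_in E F)"
    using assms finite_subset by (auto simp: closure_in_def)
  hence "spans F e" using e by (intro spans_trans[of F "closure_in E F" e]) (auto simp: closure_in_def)
  thus "e \<in> closure_in E F" using e by (simp add: closure_in_def)
qed (simp add: closure_in_def)

text \<open>If every element outside \<open>Y\<close> is parallel modulo \<open>F\<close> to an element of \<open>Y\<close>, then contracting \<open>F\<close>
  yields the restriction to \<open>Y\<close> up to parallel elements, which do not affect \<open>chi\<close>.\<close>

lemma chi_closure_skew:
  assumes fin: "finite E" and YE: "Y \<subseteq> E" and FE: "F \<subseteq> E"
    and skew: "\<And>T. T \<subseteq> Y \<Longrightarrow> r (F \<union> T) = r F + r T" and rE: "r E = r F + r Y"
    and par: "\<And>e. e \<in> E - Y \<Longrightarrow> \<not> spans F e \<Longrightarrow> \<exists>p\<in>Y. spans (insert e F) p \<and> spans (insert p F) e"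
    and G: "closed_in Y G"
  shows "closure_in E (F \<union> G) \<inter> Y = G" and "chi E (closure_in E (F \<union> G)) = chi Y G"
proof -
  define H where "H = closure_in E (F \<union> G)"
  have GY: "G \<subseteq> Y" using G by (simp add: closed_in_def)
  have finY: "finite Y" and finG: "finite G" and finF: "finite F"
    using fin YE FE GY finite_subset by (meson finite_subset)+
  have HE: "H \<subseteq> E" by (auto simp: H_def closure_in_def)
  have finH: "finite H" using HE fin finite_subset by blast
  have FGH: "F \<union> G \<subseteq> H" using YE FE GY by (auto simp: H_def closure_in_def intro: spans_mem)
  have clH: "closed_in E H" unfolding H_def using YE FE GY fin by (intro closed_in_closure_in) auto
  show HY: "closure_in E (F \<union> G) \<inter> Y = G"
  proof
    show "G \<subseteq> closure_in E (F \<union> G) \<inter> Y" using FGH GY by (auto simp: H_def)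
  next
    show "closure_in E (F \<union> G) \<inter> Y \<subseteq> G"
    proof
      fix e assume "e \<in> closure_in E (F \<union> G) \<inter> Y"
      hence e: "e \<in> Y" "r (F \<union> insert e G) = r (F \<union> G)" by (auto simp: closure_in_def spans_def)
      hence "r (insert e G) = r G" using skew[of G] skew[of "insert e G"] GY by simp
      thus "e \<in> G" using G e by (auto simp: closed_in_def spans_def)
    qed
  qed
  have split: "E - H = (E - Y - H) \<union> (Y - G)" using HY YE by (auto simp: H_def)
  let ?m = "\<lambda>B C. monom ((-1) ^ card (B \<union> C)) (r E - r (B \<union> C \<union> H)) :: int poly"
  have "chi E H = (\<Sum>B\<in>Pow (E - Y - H). \<Sum>C\<in>Pow (Y - G). ?m B C)"
    unfolding chi_def split using fin finY by (intro sum_Pow_Un) auto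
  \<comment> \<open>A nonempty \<open>B\<close> contributes nothing: the partner \<open>p\<close> of
    one of its elements lies in \<open>Y - G\<close>, and \<open>B\<close> together with
    \<open>H\<close> spans it, so it can be toggled.\<close>
  also have "\<dots> = (\<Sum>B\<in>Pow (E - Y - H). if B = {} then chi Y G else 0)"
  proof (intro sum.cong refl)
    fix B assume "B \<in> Pow (E - Y - H)"
    hence B: "B \<subseteq> E - Y - H" by auto
    hence "finite B" using fin by (meson finite_Diff finite_subset)
    show "(\<Sum>C\<in>Pow (Y - G). ?m B C) = (if B = {} then chi Y G else 0)"
    proof (cases "B = {}")
      case True
      have "r E - r (C \<union> H) = r Y - r (C \<union> G)" if "C \<subseteq> Y - G" for C
      proof -
        have "finite C" using that finY finite_subset by blast
        hence "r (C \<union> H) = r (F \<union> (C \<union> G))"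
          using rank_closure_in_Un[of E C "F \<union> G"] fin FE GY YE
          by (simp add: H_def Un_ac)
        also have "\<dots> = r F + r (C \<union> G)" using that GY by (intro skew) auto
        finally show ?thesis using rE by simp
      qed
      thus ?thesis using True by (simp add: chi_def)
    next
      case False
      then obtain e where e: "e \<in> B" by auto
      hence eH: "e \<in> E - Y" "e \<notin> H" using B by auto
      have "\<not> spans F e"
      proof
        assume "spans F e"
        hence "spans H e" using FGH finH by (intro spans_mono[of H F]) auto
        thus False using clH eH by (auto simp: closed_in_def)
      qed
      then obtain p where p: "p \<in> Y" "spans (insert e F) p" "spans (insert p F) e"
        using par eH by blast
      have pG: "p \<notin> G"
      proof
        assume "p \<in> G"
        hence "spans H e" using FGH finH by (intro spans_mono[OF _ _ p(3)]) auto
        thus False using clH eH by (auto simp: closed_in_def)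
      qed
      have eq: "?m B C = (-1) ^ card B * ((-1) ^ card C * monom 1 (r E - r (B \<union> C \<union> H)))"
        if "C \<in> Pow (Y - G)" for C
      proof -
        have "card (B \<union> C) = card B + card C"
          using that B \<open>finite B\<close> finite_subset[OF _ finY, of C] by (intro card_Un_disjoint) auto
        thus ?thesis by (simp add: monom_sign_add)
      qed
      have "(\<Sum>C\<in>Pow (Y - G). (-1) ^ card C * monom (1::int) (r E - r (B \<union> C \<union> H))) = 0"
      proof (rule sum_alternating_Pow_toggle[of _ p])
        fix C assume "C \<subseteq> Y - G - {p}"
        hence "finite C" using finY finite_subset by blast
        hence "spans (B \<union> C \<union> H) p"
          using e B \<open>finite B\<close> FGH finH by (intro spans_mono[OF _ _ p(2)]) auto
        thus "monom (1::int) (r E - r (B \<union> insert p C \<union> H)) = monom 1 (r E - r (B \<union> C \<union> H))"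
          by (simp add: spans_def)
      qed (use finY p pG in auto)
      hence "(\<Sum>C\<in>Pow (Y - G). ?m B C) = 0" using eq by (simp add: sum_distrib_left[symmetric])
      thus ?thesis using False by simp
    qed
  qed
  also have "\<dots> = chi Y G" using fin by simp
  finally show "chi E (closure_in E (F \<union> G)) = chi Y G" by (simp add: H_def)
qed

section \<open>Divisional chains: concatenation, gluing, exchange\<close>

text \<open>The part of a divisional flag that leads up to a complement of \<open>X\<close>. A
  closed set that avoids \<open>X\<close> spans no element of \<open>X\<close>, so
  \<open>modular_over\<close> makes every member of the chain skew to the sets in question; this is
  \<open>divisional_chain_skew\<close>.\<close>

definition divisional_chain :: "'a set \<Rightarrow> 'a set \<Rightarrow> (nat \<Rightarrow> 'a set) \<Rightarrow> nat \<Rightarrow> bool" where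
  "divisional_chain E X F m \<longleftrightarrow> F 0 = {} \<and>
    (\<forall>i\<le>m. closed_in E (F i) \<and> r (F i) = i \<and> F i \<inter> X = {}) \<and>
    (\<forall>i<m. F i \<subseteq> F (Suc i) \<and> chi E (F (Suc i)) dvd chi E (F i)) \<and>
    r (F m \<union> X) = r E"

lemma divisional_chain_skew:
  assumes "divisional_chain E X F m" "X \<subseteq> E" "modular_over (E - X) Y X" "i \<le> m" "T \<subseteq> Y"
  shows "r (F i \<union> T) = i + r T"
proof -
  have F: "closed_in E (F i)" "r (F i) = i" "F i \<inter> X = {}"
    using assms by (auto simp: divisional_chain_def)
  have "\<not> spans (F i) x" if "x \<in> X" for x
    using that F assms(2) by (auto simp: closed_in_def)
  moreover have "F i \<subseteq> E - X" using F by (auto simp: closed_in_def)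
  ultimately show ?thesis using assms(3,5) F(2) unfolding modular_over_def by metis
qed

text \<open>\<open>F m\<close> is a complement of the modular \<open>Y\<close>, so contracting it
  leaves \<open>Y\<close> up to parallel elements. Joining \<open>F m\<close> to the flats of the
  second chain therefore preserves their polynomials, and with them the divisibilities.\<close>

lemma divisional_chain_trans:
  assumes fin: "finite E" and YE: "Y \<subseteq> E" and XY: "X \<subseteq> Y" and mod: "modular_over (E - Y) Y Y"
    and F: "divisional_chain E Y F m" and G: "divisional_chain Y X G k"
  shows "divisional_chain E X
    (\<lambda>i. if i \<le> m then F i else closure_in E (F m \<union> G (i - m))) (m + k)" (is "divisional_chain _ _ ?H _")
proof -
  note skew = divisional_chain_skew[OF F YE mod order_refl]
  have Fi: "closed_in E (F i)" "r (F i) = i" "F i \<inter> Y = {}" if "i \<le> m" for i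
    using that F by (auto simp: divisional_chain_def)
  have Gj: "closed_in Y (G j)" "r (G j) = j" "G j \<inter> X = {}" if "j \<le> k" for j
    using that G by (auto simp: divisional_chain_def)
  have FE: "F m \<subseteq> E" using Fi by (simp add: closed_in_def)
  have GY: "G j \<subseteq> Y" if "j \<le> k" for j using Gj[OF that] by (simp add: closed_in_def)
  have finF: "finite (F m)" using FE fin finite_subset by blast
  have finY: "finite Y" using YE fin finite_subset by blast
  have finX: "finite X" using XY finY finite_subset by blast
  have rE: "r E = r (F m) + r Y" using F skew[of Y] Fi by (simp add: divisional_chain_def)
  \<comment> \<open>If \<open>F m\<close> together with \<open>e\<close> were still skew to
    \<open>Y\<close>, their union would exceed the rank of \<open>E\<close>. Hence modularity
    supplies an element \<open>p\<close> of \<open>Y\<close> that they span, and exchange gives the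
    converse.\<close>
  have par: "\<exists>p\<in>Y. spans (insert e (F m)) p \<and> spans (insert p (F m)) e"
    if "e \<in> E - Y" "\<not> spans (F m) e" for e
  proof -
    have "insert e (F m) \<subseteq> E - Y" using that FE Fi[of m] by auto
    moreover have "r (insert e (F m) \<union> Y) \<noteq> r (insert e (F m)) + r Y"
    proof -
      have "r (insert e (F m) \<union> Y) \<le> r E" using that FE YE fin by (intro rank_mono) auto
      thus ?thesis using rE rank_insert_not_spans[OF finF that(2)] by simp
    qed
    ultimately obtain p where p: "p \<in> Y" "spans (insert e (F m)) p"
      using mod unfolding modular_over_def by (metis order_refl)
    moreover have "\<not> spans (F m) p" using Fi[of m] p YE by (auto simp: closed_in_def)
    ultimately show ?thesis using spans_exchange[OF finF] by blast
  qed
  have skew': "r (F m \<union> T) = r (F m) + r T" if "T \<subseteq> Y" for T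
    using skew[OF that] Fi by simp
  note cs = chi_closure_skew[OF fin YE FE skew' rE par Gj(1)]
  have G0: "G 0 = {}" using G by (simp add: divisional_chain_def)
  have H0: "closure_in E (F m) = F m"
    using Fi[of m] FE by (auto simp: closure_in_def closed_in_def intro: spans_mem)
  \<comment> \<open>The two branches agree at \<open>i = m\<close>, so the step from
    \<open>m\<close> to \<open>m + 1\<close> takes place within the second one.\<close>
  have H: "?H i = closure_in E (F m \<union> G (i - m))" if "m \<le> i" for i
    using that H0 G0 by auto
  have FG: "F m \<union> G j \<subseteq> E" if "j \<le> k" for j using FE GY[OF that] YE by auto
  show ?thesis unfolding divisional_chain_def
  proof (intro conjI allI impI)
    show "?H 0 = {}" using F by (simp add: divisional_chain_def)
  next
    fix i assume i: "i \<le> m + k"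
    show "closed_in E (?H i)"
      using Fi FG[of "i - m"] closed_in_closure_in[OF fin] i by auto
    show "r (?H i) = i"
    proof (cases "i \<le> m")
      case False
      hence "r (?H i) = r (F m \<union> G (i - m))"
        using rank_closure_in_Un[OF fin, of "{}" "F m \<union> G (i - m)"] FG[of "i - m"] i by simp
      thus ?thesis using skew[OF GY, of "i - m"] Gj(2)[of "i - m"] i False by simp
    qed (simp add: Fi)
    show "?H i \<inter> X = {}"
    proof (cases "i \<le> m")
      case False
      hence "closure_in E (F m \<union> G (i - m)) \<inter> Y = G (i - m)" using cs(1)[of "i - m"] i by simp
      moreover have "G (i - m) \<inter> X = {}" using Gj(3)[of "i - m"] i by simp
      ultimately have "closure_in E (F m \<union> G (i - m)) \<inter> X = {}" using XY by blast
      thus ?thesis using False by simp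
    next
      case True
      thus ?thesis using Fi(3)[of i] XY by auto
    qed
  next
    fix i assume i: "i < m + k"
    have "?H i \<subseteq> ?H (Suc i) \<and> chi E (?H (Suc i)) dvd chi E (?H i)"
    proof (cases "i < m")
      case True
      thus ?thesis using F by (simp add: divisional_chain_def)
    next
      case False
      define j where "j = i - m"
      have j: "j < k" "i = m + j" using i False by (auto simp: j_def)
      have Hi: "?H i = closure_in E (F m \<union> G j)" "?H (Suc i) = closure_in E (F m \<union> G (Suc j))"
        using H[of i] j by auto
      have sub: "G j \<subseteq> G (Suc j)" and dvd: "chi Y (G (Suc j)) dvd chi Y (G j)"
        using G j by (auto simp: divisional_chain_def)
      have "finite (F m \<union> G (Suc j))" using FG[of "Suc j"] j fin finite_subset[of _ E] by auto
      hence "closure_in E (F m \<union> G j) \<subseteq> closure_in E (F m \<union> G (Suc j))"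
        using sub unfolding closure_in_def
        by (auto intro: spans_mono[of "F m \<union> G (Suc j)" "F m \<union> G j"])
      moreover have "chi E (closure_in E (F m \<union> G (Suc j))) dvd chi E (closure_in E (F m \<union> G j))"
        using dvd cs(2)[of j] cs(2)[of "Suc j"] j by simp
      ultimately show ?thesis by (simp only: Hi)
    qed
    thus "?H i \<subseteq> ?H (Suc i)" "chi E (?H (Suc i)) dvd chi E (?H i)" by auto
  next
    have "r (?H (m + k) \<union> X) = r (F m \<union> (G k \<union> X))"
      using H[of "m + k"] rank_closure_in_Un[OF fin finX FG[of k]] by (simp add: Un_assoc)
    also have "\<dots> = m + r Y"
      using skew[of "G k \<union> X"] GY[of k] XY G by (simp add: divisional_chain_def)
    finally show "r (?H (m + k) \<union> X) = r E" using rE Fi by simp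
  qed
qed

text \<open>In \<open>E\<close> and in \<open>E \<union> Y\<close> the flat \<open>F i\<close> has
  the same \<open>modular_factor\<close>, since the coranks of \<open>X\<close> and of
  \<open>Y\<close> are both \<open>m\<close>. This yields the identity \<open>fact\<close>.
  Divisibility in \<open>E\<close>, multiplied by \<open>chi Y {}\<close>, is divisibility in
  \<open>E \<union> Y\<close> multiplied by \<open>chi X {}\<close>, which is nonzero.\<close>

lemma divisional_chain_glue:
  assumes fin: "finite E" "finite Y" and X: "E \<inter> Y = X" and nl: "\<And>e. e \<in> Y \<Longrightarrow> r {e} = 1"
    and mod: "modular_over (E - X) Y X" and F: "divisional_chain E X F m"
  shows "divisional_chain (E \<union> Y) Y F m"
proof -
  have XE: "X \<subseteq> E" and XY: "X \<subseteq> Y" using X by auto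
  note skew = divisional_chain_skew[OF F XE mod]
  have Fi: "closed_in E (F i)" "r (F i) = i" "F i \<inter> X = {}" if "i \<le> m" for i
    using that F by (auto simp: divisional_chain_def)
  have FE: "F i \<subseteq> E - X" if "i \<le> m" for i using Fi[OF that] by (auto simp: closed_in_def)
  have finX: "finite X" using XE fin finite_subset by blast
  have rE: "r E = r X + m" using F skew[of m X] XY by (simp add: divisional_chain_def)
  have rFY: "r (F m \<union> Y) = r (E \<union> Y)"
  proof -
    have "finite (F m)" using FE[of m] fin finite_subset by blast
    have "spans (F m \<union> X) e" if "e \<in> E" for e
      using F fin FE[of m] XE that
      by (intro spans_of_rank_eq[of E]) (auto simp: divisional_chain_def)
    hence "spans (F m \<union> Y) e" if "e \<in> E" for e
      using that XY fin \<open>finite (F m)\<close> by (auto intro: spans_mono[of "F m \<union> Y" "F m \<union> X"])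
    hence "r (F m \<union> Y \<union> E) = r (F m \<union> Y)"
      using fin \<open>finite (F m)\<close> by (intro rank_Un_spans) auto
    moreover have "F m \<union> Y \<union> E = E \<union> Y" using FE[of m] by auto
    ultimately show ?thesis by simp
  qed
  hence rEY: "r (E \<union> Y) = r Y + m" using skew[of m Y] by simp
  have fact: "chi (E \<union> Y) (F i) * chi X {} = chi E (F i) * chi Y {}" if "i \<le> m" for i
  proof -
    have "E - X \<union> Y = E \<union> Y" "E - X \<union> X = E" using X by auto
    moreover have "modular_over (E - X) X X" using modular_over_mono[OF mod XY] by simp
    ultimately have "chi (E \<union> Y) (F i) = modular_factor (E - X) X (F i) m * chi Y {}"
      "chi E (F i) = modular_factor (E - X) X (F i) m * chi X {}"
      using chi_modular_factor[of "E - X" Y X "F i" m] chi_modular_factor[of "E - X" X X "F i" m]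
        fin finX X XY FE[OF that] mod rE rEY by auto
    thus ?thesis by simp
  qed
  have X0: "chi X {} \<noteq> 0" using finX nl XY by (intro chi_nonzero) auto
  show ?thesis unfolding divisional_chain_def
  proof (intro conjI allI impI)
    fix i assume i: "i \<le> m"
    show "F i \<inter> Y = {}" using FE[OF i] X by auto
    show "r (F i) = i" using Fi i by simp
    show "closed_in (E \<union> Y) (F i)"
      unfolding closed_in_def
    proof (intro conjI ballI impI)
      fix e assume e: "e \<in> E \<union> Y" "spans (F i) e"
      have "e \<notin> Y"
      proof
        assume "e \<in> Y"
        hence "r (F i \<union> {e}) = i + 1" using skew[OF i, of "{e}"] nl by simp
        thus False using e Fi(2)[OF i] by (simp add: spans_def)
      qed
      thus "e \<in> F i" using e Fi(1)[OF i] by (auto simp: closed_in_def)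
    qed (use FE[OF i] in auto)
  next
    fix i assume i: "i < m"
    hence "chi E (F (Suc i)) dvd chi E (F i)" using F by (simp add: divisional_chain_def)
    hence "chi E (F (Suc i)) * chi Y {} dvd chi E (F i) * chi Y {}" by (rule mult_dvd_mono) simp
    hence "chi (E \<union> Y) (F (Suc i)) * chi X {} dvd chi (E \<union> Y) (F i) * chi X {}"
      using fact[of i] fact[of "Suc i"] i by simp
    thus "chi (E \<union> Y) (F (Suc i)) dvd chi (E \<union> Y) (F i)" using X0 by simp
  qed (use F rFY in \<open>auto simp: divisional_chain_def\<close>)
qed

text \<open>The line through \<open>e\<close> and another element outside \<open>Y\<close> meets the
  modular \<open>Y\<close> of corank one. Contracting \<open>e\<close> therefore gives
  \<open>Y\<close> up to parallel elements, and the polynomial of \<open>Y\<close> divides that of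
  \<open>E\<close> by modular factorization.\<close>

lemma divisional_chain_coatom:
  assumes fin: "finite E" and YE: "Y \<subseteq> E" and mod: "modular_over (E - Y) Y Y"
    and rE: "r E = Suc (r Y)" and simple: "\<And>a b. a \<in> E \<Longrightarrow> b \<in> E \<Longrightarrow> spans {a} b \<Longrightarrow> a = b"
    and nl: "\<And>a. a \<in> E \<Longrightarrow> r {a} = 1" and e: "e \<in> E - Y"
  shows "divisional_chain E Y (\<lambda>i. if i = 0 then {} else {e}) 1"
proof -
  have finY: "finite Y" using YE fin finite_subset by blast
  have nsp: "\<not> spans {} a" if "a \<in> E" for a using nl[OF that] by (simp add: spans_def)
  have "\<not> spans {e} y" if "y \<in> Y" for y using simple[of e y] e YE that by auto
  hence skew: "r ({e} \<union> T) = r {e} + r T" if "T \<subseteq> Y" for T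
    using mod that e unfolding modular_over_def
    by (metis Diff_iff empty_subsetI insert_subset)
  have re: "r {e} = 1" using nl e by simp
  have par: "\<exists>p\<in>Y. spans (insert a {e}) p \<and> spans (insert p {e}) a"
    if a: "a \<in> E - Y" "\<not> spans {e} a" for a
  proof -
    have "r (insert a {e} \<union> Y) \<le> r E" using a e YE fin by (intro rank_mono) auto
    moreover have "r (insert a {e}) = 2" using rank_insert_not_spans[of "{e}" a] a re by simp
    ultimately have "r (insert a {e} \<union> Y) \<noteq> r (insert a {e}) + r Y" using rE by simp
    moreover have "insert a {e} \<subseteq> E - Y" using a e by auto
    ultimately obtain p where p: "p \<in> Y" "spans (insert a {e}) p"
      using mod unfolding modular_over_def by (metis order_refl)
    moreover have "\<not> spans {e} p" using simple[of e p] p YE e by auto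
    ultimately show ?thesis using spans_exchange[of "{e}" a p] by auto
  qed
  have cle: "closed_in E {e}" using simple e by (auto simp: closed_in_def)
  have "closed_in Y {}" using nsp YE by (auto simp: closed_in_def)
  moreover have "closure_in E ({e} \<union> {}) = {e}"
    using cle e by (auto simp: closure_in_def closed_in_def intro: spans_mem)
  ultimately have "chi E {e} = chi Y {}"
    using chi_closure_skew(2)[OF fin YE, of "{e}" "{}"] skew par re rE e by auto
  moreover have "chi E {} = modular_factor (E - Y) Y {} 1 * chi Y {}"
  proof -
    have "E - Y \<union> Y = E" using YE by auto
    thus ?thesis using chi_modular_factor[of "E - Y" Y Y "{}" 1] fin finY mod rE by auto
  qed
  ultimately have "chi E {e} dvd chi E {}" by simp
  moreover have "r ({e} \<union> Y) = r E" using skew[of Y] re rE by simp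
  moreover have "closed_in E {}" using nsp by (auto simp: closed_in_def)
  ultimately show ?thesis
    unfolding divisional_chain_def using cle e re by auto
qed

lemma rank_submodular:
  assumes "finite S'" "finite U" "S \<subseteq> S'"
  shows "r (S' \<union> U) + r S \<le> r (S \<union> U) + r S'"
  using assms(2)
proof (induction U)
  case (insert u U)
  have fin: "finite (S' \<union> U)" "finite (S \<union> U)" using insert.hyps assms finite_subset by auto
  have "spans (S' \<union> U) u" if "spans (S \<union> U) u"
    using spans_mono[OF fin(1) _ that] assms by blast
  hence "r (insert u (S' \<union> U)) + r (S \<union> U) \<le> r (insert u (S \<union> U)) + r (S' \<union> U)"
    using rank_insert_cases[OF fin(1), of u] rank_insert_cases[OF fin(2), of u]
    by (auto simp: spans_def)
  thus ?case using insert.IH by simp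
qed simp

text \<open>The conditions on consecutive members do not mention \<open>X\<close>, so the flats can
  be kept. From index 1 on they contain \<open>e\<close>, modulo which \<open>X\<close> and
  \<open>X'\<close> span the same; this gives the condition at the end. Only disjointness from
  \<open>X\<close> needs an argument.\<close>

lemma divisional_chain_exchange:
  assumes fin: "finite E" and XE: "X \<subseteq> E" "X' \<subseteq> E" and nl: "\<And>x. x \<in> X \<Longrightarrow> r {x} = 1"
    and mod: "modular_over (E - X') X' X'" and F: "divisional_chain E X' F (Suc k)" "F 1 = {e}"
    and sp: "\<And>x. x \<in> X \<Longrightarrow> spans (insert e X') x" "\<And>x. x \<in> X' \<Longrightarrow> spans (insert e X) x"
    and e: "\<not> spans X e"
  shows "divisional_chain E X F (Suc k)"
proof -
  note skew = divisional_chain_skew[OF F(1) XE(2) mod]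
  have finX: "finite X" "finite X'" using XE fin finite_subset by blast+
  have eF: "e \<in> F i" if "1 \<le> i" "i \<le> Suc k" for i
    using that
  proof (induction i rule: nat_induct_at_least)
    case (Suc i)
    hence "F i \<subseteq> F (Suc i)" using F(1) by (simp add: divisional_chain_def)
    thus ?case using Suc by auto
  qed (use F in simp)
  have eq: "r (F i \<union> X) = r (F i \<union> X')" if "1 \<le> i" "i \<le> Suc k" for i
  proof (rule rank_eq_of_spans)
    have "F i \<subseteq> E" using F(1) that by (auto simp: divisional_chain_def closed_in_def)
    hence "finite (F i)" using fin finite_subset by blast
    thus fin': "finite (F i \<union> X)" "finite (F i \<union> X')" using finX by auto
    show "spans (F i \<union> X) x" if "x \<in> F i \<union> X'" for x
      using that spans_mono[OF fin'(1) _ sp(2)] eF[OF \<open>1 \<le> i\<close> \<open>i \<le> Suc k\<close>] spans_mem by auto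
    show "spans (F i \<union> X') x" if "x \<in> F i \<union> X" for x
      using that spans_mono[OF fin'(2) _ sp(1)] eF[OF \<open>1 \<le> i\<close> \<open>i \<le> Suc k\<close>] spans_mem by auto
  qed
  \<comment> \<open>Index 1 suffices: joining \<open>e\<close> raises both ranks by one, and the
    joins have equal rank.\<close>
  have rX: "r X = r X'"
    using eq[of 1] skew[of 1 X'] rank_insert_not_spans[OF finX(1) e] F(2) by simp
  have disj: "F i \<inter> X = {}" if i: "i \<le> Suc k" for i
  proof (cases "i = 0")
    case False
    show ?thesis
    proof (rule ccontr)
      assume "F i \<inter> X \<noteq> {}"
      then obtain x where x: "x \<in> F i" "x \<in> X" by auto
      have "F i \<subseteq> E" and ri: "r (F i) = i" using F(1) i by (auto simp: divisional_chain_def closed_in_def)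
      hence "finite (F i)" using fin finite_subset by blast
      \<comment> \<open>A common element would cost one in the rank of the union, which is however
        the full \<open>i + r X\<close>.\<close>
      hence "r (F i \<union> X) + r {x} \<le> r ({x} \<union> X) + r (F i)"
        using x finX by (intro rank_submodular) auto
      moreover have "r (F i \<union> X) = i + r X" using eq[of i] skew[OF i, of X'] rX False i by simp
      ultimately show False using nl[OF x(2)] x ri by (simp add: insert_absorb)
    qed
  qed (use F(1) in \<open>simp add: divisional_chain_def\<close>)
  show ?thesis using F(1) disj eq[of "Suc k"] by (auto simp: divisional_chain_def)
qed

section \<open>From rank functions to matroids and divisional flags\<close>

text \<open>A greedily chosen independent subset attains \<open>r S\<close>, so the maximum that
  defines \<open>rank\<close> is the given rank function.\<close>

lemma rank_indep_system:
  assumes "finite E" and M: "\<And>I. indep M I \<longleftrightarrow> I \<subseteq> E \<and> r I = card I" and "S \<subseteq> E"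
  shows "rank M S = r S"
proof -
  have fin: "finite S" using assms finite_subset by blast
  have le: "r T \<le> card T" if "finite T" for T
    using that
  proof (induction T)
    case (insert t T)
    thus ?case using rank_insert_cases[of T t] by auto
  qed simp
  have "\<exists>I\<subseteq>T. r I = card I \<and> card I = r T" if "finite T" for T
    using that
  proof (induction T)
    case (insert t T)
    then obtain I where I: "I \<subseteq> T" "r I = card I" "card I = r T" by auto
    have finI: "finite I" using I insert finite_subset by blast
    show ?case
    proof (cases "spans T t")
      case True
      thus ?thesis using I by (intro exI[of _ I]) (auto simp: spans_def)
    next
      case False
      hence "\<not> spans I t" using spans_mono[of T I t] I insert by blast
      thus ?thesis
        using I finI insert rank_insert_not_spans[of I t] rank_insert_not_spans[of T t] False
        by (intro exI[of _ "insert t I"]) (auto simp: card_insert_if)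
    qed
  qed auto
  from this[OF fin] obtain I where I: "I \<subseteq> S" "r I = card I" "card I = r S" by blast
  have "Max (card ` {I. I \<subseteq> S \<and> indep M I}) = r S"
  proof (rule Max_eqI)
    show "finite (card ` {I. I \<subseteq> S \<and> indep M I})" using fin by simp
  next
    fix y assume "y \<in> card ` {I. I \<subseteq> S \<and> indep M I}"
    then obtain J where "J \<subseteq> S" "y = r J" using M by auto
    thus "y \<le> r S" using rank_mono[OF fin] by simp
  next
    show "r S \<in> card ` {I. I \<subseteq> S \<and> indep M I}"
      using I M assms(3) by (intro image_eqI[of _ _ I]) auto
  qed
  thus ?thesis by (simp add: rank_def)
qed

lemma flats_indep_system:
  assumes "finite E" "ground M = E" "\<And>I. indep M I \<longleftrightarrow> I \<subseteq> E \<and> r I = card I"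
  shows "flats M = {F. closed_in E F}"
proof -
  have "(\<forall>e\<in>E - F. rank M F < rank M (insert e F)) \<longleftrightarrow> (\<forall>e\<in>E. spans F e \<longrightarrow> e \<in> F)"
    if "F \<subseteq> E" for F
  proof -
    have "finite F" using that assms finite_subset by blast
    have "rank M F < rank M (insert e F) \<longleftrightarrow> \<not> spans F e" if "e \<in> E" for e
      using rank_indep_system[OF assms(1,3)] that \<open>F \<subseteq> E\<close> rank_insert_cases[OF \<open>finite F\<close>, of e]
      by (auto simp: spans_def)
    thus ?thesis by blast
  qed
  thus ?thesis using assms(2) by (auto simp: flats_def closed_in_def)
qed

text \<open>Whitney's subset expansion: the signed number of sets with closure \<open>F\<close> satisfies the recursion
  of the Moebius function.\<close>

lemma char_poly_indep_system:
  assumes fin: "finite E" and gr: "ground M = E"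
    and M: "\<And>I. indep M I \<longleftrightarrow> I \<subseteq> E \<and> r I = card I" and nl: "\<And>e. e \<in> E \<Longrightarrow> r {e} = 1"
  shows "char_poly M = chi E {}"
proof -
  let ?L = "{F. closed_in E F}"
  let ?c = "\<lambda>F. \<Sum>S\<in>{S \<in> Pow E. closure_in E S = F}. (-1) ^ card S :: int"
  have L: "flats M = ?L" by (rule flats_indep_system[OF fin gr M])
  have finL: "finite ?L" using fin by (intro finite_subset[of ?L "Pow E"]) (auto simp: closed_in_def)
  have emp: "closed_in E {}" using nl by (auto simp: closed_in_def spans_def)
  have Inter: "\<Inter>?L = {}" using emp by blast
  have cl_sub: "closure_in E S \<subseteq> F \<longleftrightarrow> S \<subseteq> F" if "S \<subseteq> E" "closed_in E F" for S F
  proof -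
    have "finite F" using that fin finite_subset by (auto simp: closed_in_def)
    thus ?thesis using that spans_mono[of F S] spans_mem[of _ S]
      by (fastforce simp: closure_in_def closed_in_def)
  qed
  have mob: "mobius ?L {} F = ?c F" if "closed_in E F" for F
  proof -
    have "finite F" using that fin finite_subset by (auto simp: closed_in_def)
    thus ?thesis using that
    proof (induction F rule: finite_psubset_induct)
      case (psubset F)
      have FE: "F \<subseteq> E" using psubset.prems by (simp add: closed_in_def)
      let ?B = "{Z \<in> ?L. Z \<subset> F}"
      have finB: "finite ?B" using finL by simp
      \<comment> \<open>The subsets of \<open>F\<close> are grouped by closure; a set has its
        closure below the flat \<open>F\<close> only if it is itself contained in
        \<open>F\<close>.\<close>
      have "(\<Sum>Z\<in>insert F ?B. ?c Z) = (\<Sum>S\<in>Pow F. (-1) ^ card S)"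
      proof -
        have "(\<Sum>Z\<in>insert F ?B. ?c Z) = (\<Sum>Z\<in>insert F ?B. \<Sum>S\<in>{S \<in> Pow F. closure_in E S = Z}. (-1) ^ card S)"
        proof (intro sum.cong refl Collect_cong)
          fix Z S assume Z: "Z \<in> insert F ?B"
          have "S \<subseteq> F" if "S \<subseteq> E" "closure_in E S = Z"
            using that Z cl_sub[of S F] psubset.prems by blast
          thus "S \<in> Pow E \<and> closure_in E S = Z \<longleftrightarrow> S \<in> Pow F \<and> closure_in E S = Z"
            using FE by blast
        qed
        also have "\<dots> = (\<Sum>S\<in>Pow F. (-1) ^ card S)"
        proof (intro sum.group)
          show "closure_in E ` Pow F \<subseteq> insert F ?B"
          proof (rule image_subsetI)
            fix S assume "S \<in> Pow F"
            hence "S \<subseteq> F" "S \<subseteq> E" using FE by auto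
            hence "closed_in E (closure_in E S)" "closure_in E S \<subseteq> F"
              using closed_in_closure_in[OF fin] cl_sub[of S F] psubset.prems by simp_all
            thus "closure_in E S \<in> insert F ?B" by blast
          qed
        qed (use finB psubset.hyps in auto)
        finally show ?thesis .
      qed
      moreover have "(\<Sum>S\<in>Pow F. (-1) ^ card S) = (if F = {} then 1 else (0::int))"
      proof (cases "F = {}")
        case False
        then obtain x where "x \<in> F" by auto
        from sum_alternating_Pow_toggle[OF psubset.hyps this, of "\<lambda>_. 1::int"] False
        show ?thesis by simp
      qed simp
      ultimately have "?c F + (\<Sum>Z\<in>?B. ?c Z) = (if F = {} then 1 else 0)"
        using finB by simp
      moreover have "(\<Sum>Z\<in>?B. ?c Z) = (\<Sum>Z\<in>?B. mobius ?L {} Z)"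
        using psubset.IH by (intro sum.cong) auto
      ultimately have sum: "?c F + (\<Sum>Z\<in>?B. mobius ?L {} Z) = (if F = {} then 1 else 0)"
        by simp
      show ?case
      proof (cases "F = {}")
        case True
        hence "?B = {}" by auto
        hence "?c F = 1" using sum True by simp
        moreover have "mobius ?L {} F = 1" by (subst mobius.simps) (simp add: True)
        ultimately show ?thesis by simp
      next
        case False
        have "mobius ?L {} F = - (\<Sum>Z\<in>?B. mobius ?L {} Z)"
          using False psubset.hyps by (subst mobius.simps) simp
        moreover have "?c F = - (\<Sum>Z\<in>?B. mobius ?L {} Z)"
          using sum False by (simp only: if_False eq_neg_iff_add_eq_0)
        ultimately show ?thesis by (rule trans[OF _ sym])
      qed
    qed
  qed
  have rk: "rank M S = r S" if "S \<subseteq> E" for S using rank_indep_system[OF fin M that] .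
  have "char_poly M = (\<Sum>F\<in>?L. monom (?c F) (r E - r F))"
    unfolding char_poly_def L Inter gr
  proof (intro sum.cong refl)
    fix F assume "F \<in> ?L"
    hence "closed_in E F" "F \<subseteq> E" by (auto simp: closed_in_def)
    thus "monom (mobius ?L {} F) (rank M E - rank M F) = monom (?c F) (r E - r F)"
      using mob[of F] rk[of F] rk[of E] by simp
  qed
  also have "\<dots> = (\<Sum>F\<in>?L. \<Sum>S\<in>{S \<in> Pow E. closure_in E S = F}. monom ((-1) ^ card S) (r E - r S))"
  proof (intro sum.cong refl)
    fix F
    have "monom (?c F) (r E - r F) = (\<Sum>S\<in>{S \<in> Pow E. closure_in E S = F}. monom ((-1) ^ card S) (r E - r F))"
      by (rule monom_sum)
    also have "\<dots> = (\<Sum>S\<in>{S \<in> Pow E. closure_in E S = F}. monom ((-1) ^ card S) (r E - r S))"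
      using rank_closure_in_Un[OF fin, of "{}"] by (intro sum.cong refl) auto
    finally show "monom (?c F) (r E - r F) =
      (\<Sum>S\<in>{S \<in> Pow E. closure_in E S = F}. monom ((-1) ^ card S) (r E - r S))" .
  qed
  also have "\<dots> = (\<Sum>S\<in>Pow E. monom ((-1) ^ card S) (r E - r S))"
    using fin finL closed_in_closure_in[OF fin] by (intro sum.group) auto
  finally show ?thesis by (simp add: chi_def)
qed

text \<open>As \<open>Y\<close> is closed, the contraction has no loops, so the subset expansion
  applies to it with the contracted rank function.\<close>

lemma char_poly_contract:
  assumes fin: "finite E" and gr: "ground M = E"
    and M: "\<And>I. indep M I \<longleftrightarrow> I \<subseteq> E \<and> r I = card I" and Y: "closed_in E Y"
  shows "char_poly (contract M Y) = chi E Y"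
proof -
  have YE: "Y \<subseteq> E" using Y by (simp add: closed_in_def)
  have finY: "finite Y" using YE fin finite_subset by blast
  interpret C: rank_function "\<lambda>S. r (S \<union> Y) - r Y" by (rule rank_function_contract[OF finY])
  have le: "r Y \<le> r (S \<union> Y)" if "S \<subseteq> E" for S
    using that fin finY finite_subset by (intro rank_mono) auto
  have rk: "rank M S = r S" if "S \<subseteq> E" for S using rank_indep_system[OF fin M that] .
  have "char_poly (contract M Y) = C.chi (E - Y) {}"
  proof (rule C.char_poly_indep_system)
    fix I
    show "indep (contract M Y) I \<longleftrightarrow> I \<subseteq> E - Y \<and> r (I \<union> Y) - r Y = card I"
    proof (cases "I \<subseteq> E - Y")
      case True
      hence "I \<subseteq> E" "I \<union> Y \<subseteq> E" using YE by auto
      hence "rank M (I \<union> Y) = r (I \<union> Y)" "r Y \<le> r (I \<union> Y)" using rk le by blast+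
      thus ?thesis using True rk[OF YE] gr by (auto simp: contract_def)
    qed (simp add: contract_def gr)
  next
    fix e assume "e \<in> E - Y"
    hence "\<not> spans Y e" using Y by (auto simp: closed_in_def)
    thus "r ({e} \<union> Y) - r Y = 1" using rank_insert_not_spans[OF finY] by simp
  qed (use fin gr in \<open>auto simp: contract_def\<close>)
  also have "\<dots> = chi E Y"
    unfolding chi_def C.chi_def
  proof (intro sum.cong)
    fix S assume "S \<in> Pow (E - Y)"
    hence "r Y \<le> r (S \<union> Y)" by (intro le) auto
    moreover have "E - Y \<union> Y = E" using YE by auto
    ultimately show "monom ((-1) ^ card S) (r (E - Y \<union> Y) - r Y - (r (S \<union> {} \<union> Y) - r Y)) =
        (monom ((-1) ^ card S) (r E - r (S \<union> Y)) :: int poly)"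
      by simp
  qed simp
  finally show ?thesis .
qed

text \<open>A complement of a single element has corank one, so \<open>E\<close> itself is the only
  flat to be added. The last divisibility holds because \<open>chi E E\<close> is 1.\<close>

lemma divisional_flag_of_chain:
  assumes fin: "finite E" and gr: "ground M = E"
    and M: "\<And>I. indep M I \<longleftrightarrow> I \<subseteq> E \<and> r I = card I" and e: "e \<in> E"
    and F: "divisional_chain E {e} F m"
  shows "divisional_flag M (\<lambda>i. if i \<le> m then F i else E)"
proof -
  have Fi: "closed_in E (F i)" "r (F i) = i" "F i \<inter> {e} = {}" if "i \<le> m" for i
    using that F unfolding divisional_chain_def by blast+
  have rk: "rank M S = r S" if "S \<subseteq> E" for S using rank_indep_system[OF fin M that] .
  have FE: "F i \<subseteq> E" if "i \<le> m" for i using Fi[OF that] by (simp add: closed_in_def)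
  have "finite (F m)" using FE[of m] fin finite_subset by blast
  moreover have "\<not> spans (F m) e" using Fi[of m] e by (auto simp: closed_in_def)
  moreover have "r (insert e (F m)) = r E" using F by (simp add: divisional_chain_def)
  ultimately have rE: "r E = Suc m" using rank_insert_not_spans[of "F m" e] Fi[of m] by simp
  have EE: "closed_in E E" by (simp add: closed_in_def)
  have flats: "flats M = {F. closed_in E F}" by (rule flats_indep_system[OF fin gr M])
  note cp = char_poly_contract[OF fin gr M]
  show ?thesis
    unfolding divisional_flag_def Let_def gr rk[OF order_refl] rE flats
  proof (intro conjI allI impI)
    fix i assume "i < Suc m"
    hence i: "i \<le> m" by simp
    show "(if i \<le> m then F i else E) \<subseteq> (if Suc i \<le> m then F (Suc i) else E)"
      using F FE[OF i] i by (auto simp: divisional_chain_def)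
    show "char_poly (contract M (if Suc i \<le> m then F (Suc i) else E)) dvd
        char_poly (contract M (if i \<le> m then F i else E))"
      using F i cp[OF Fi(1)] cp[OF EE] by (auto simp: divisional_chain_def chi_ground)
  qed (use F Fi EE FE rk rE in \<open>auto simp: divisional_chain_def le_Suc_eq\<close>)
qed

text \<open>Elements outside the image of \<open>b\<close> act as loops. In this way the axioms hold
  for arbitrary sets, as the locale demands.\<close>

lemma rank_function_vimage:
  assumes fin: "finite E" and inj: "inj_on b E"
  shows "rank_function (\<lambda>S. r {f \<in> E. b f \<in> S})"
proof -
  have ins: "{f \<in> E. b f \<in> insert H S} =
      (if H \<in> b ` E then insert (the_inv_into E b H) {f \<in> E. b f \<in> S} else {f \<in> E. b f \<in> S})" for H S
    using inj by (auto simp: the_inv_into_f_f inj_on_eq_iff[OF inj])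
  have finv: "finite {f \<in> E. b f \<in> S}" for S using fin by simp
  show ?thesis
  proof
    fix S :: "'b set" and H
    show "r {f \<in> E. b f \<in> insert H S} = r {f \<in> E. b f \<in> S} \<or>
        r {f \<in> E. b f \<in> insert H S} = Suc (r {f \<in> E. b f \<in> S})"
      unfolding ins using rank_insert_cases[OF finv] by simp
  next
    fix S T :: "'b set" and H
    assume "S \<subseteq> T" and *: "r {f \<in> E. b f \<in> insert H S} = r {f \<in> E. b f \<in> S}"
    hence "{f \<in> E. b f \<in> S} \<subseteq> {f \<in> E. b f \<in> T}" by auto
    thus "r {f \<in> E. b f \<in> insert H T} = r {f \<in> E. b f \<in> T}"
      using * rank_insert_mono[OF finv] unfolding ins by (simp split: if_splits)
  qed simp
qed

lemma divisional_chain_image: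
  assumes r': "rank_function r'" and inj: "inj_on b E" and eq: "\<And>S. S \<subseteq> E \<Longrightarrow> r' (b ` S) = r S"
    and XE: "X \<subseteq> E" and F: "divisional_chain E X F m"
  shows "rank_function.divisional_chain r' (b ` E) (b ` X) (\<lambda>i. b ` F i) m"
proof -
  interpret R: rank_function r' by (rule r')
  have chi: "R.chi (b ` E) (b ` Y) = chi E Y" if Y: "Y \<subseteq> E" for Y
  proof -
    have "b ` E - b ` Y = b ` (E - Y)" using inj Y by (auto simp: inj_on_def)
    moreover have "inj_on b (E - Y)" using inj by (rule inj_on_diff)
    hence "inj_on (image b) (Pow (E - Y))" by (rule inj_on_image_Pow)
    moreover have "Pow (b ` (E - Y)) = image b ` Pow (E - Y)" by (simp add: image_Pow_surj)
    ultimately have "R.chi (b ` E) (b ` Y) =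
        (\<Sum>S\<in>Pow (E - Y). monom ((-1) ^ card (b ` S)) (r' (b ` E) - r' (b ` S \<union> b ` Y)))"
      by (simp add: R.chi_def sum.reindex)
    also have "\<dots> = chi E Y"
      unfolding chi_def
    proof (intro sum.cong refl)
      fix S assume S: "S \<in> Pow (E - Y)"
      hence "inj_on b S" using inj inj_on_subset by blast
      hence "card (b ` S) = card S" by (rule card_image)
      moreover have "r' (b ` S \<union> b ` Y) = r (S \<union> Y)" using S Y eq[of "S \<union> Y"] by (simp add: image_Un) blast
      ultimately show "monom ((-1) ^ card (b ` S)) (r' (b ` E) - r' (b ` S \<union> b ` Y)) =
          (monom ((-1) ^ card S) (r E - r (S \<union> Y)) :: int poly)"
        using eq[of E] by simp
    qed
    finally show ?thesis .
  qed
  have cl: "R.closed_in (b ` E) (b ` Y)" if "closed_in E Y" for Y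
  proof -
    have "R.spans (b ` Y) (b e) \<longleftrightarrow> spans Y e" if "e \<in> E" for e
      using that \<open>closed_in E Y\<close> eq[of Y] eq[of "insert e Y"]
      by (simp add: R.spans_def spans_def closed_in_def)
    thus ?thesis using that by (auto simp: R.closed_in_def closed_in_def)
  qed
  have Fi: "F i \<subseteq> E" "closed_in E (F i)" "r (F i) = i" "F i \<inter> X = {}" if "i \<le> m" for i
    using that F by (auto simp: divisional_chain_def closed_in_def)
  have "b ` F i \<subseteq> b ` F (Suc i)" if "i < m" for i
    using that F by (intro image_mono) (simp add: divisional_chain_def)
  moreover have "b ` F i \<inter> b ` X = {}" if "i \<le> m" for i
    using Fi[OF that] XE inj by (metis image_empty inj_on_image_Int)
  moreover have "r' (b ` F m \<union> b ` X) = r' (b ` E)"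
    using F eq[of "F m \<union> X"] eq[of E] Fi[of m] XE by (simp add: divisional_chain_def image_Un)
  ultimately show ?thesis
    using F Fi cl eq chi unfolding R.divisional_chain_def divisional_chain_def
    by (auto simp: Suc_le_eq)
qed

end

section \<open>Gain vectors\<close>

lemma coord_dim_insert:
  fixes S :: "(nat \<Rightarrow> 'k::field) set"
  assumes "finite S"
  shows "coord.dim (insert e S) = (if e \<in> coord.span S then coord.dim S else Suc (coord.dim S))"
proof (cases "e \<in> coord.span S")
  case True
  hence "coord.dim (insert e S) = coord.dim S" by (intro coord.span_eq_dim coord.span_redundant)
  thus ?thesis using True by simp
next
  case False
  obtain B where B: "B \<subseteq> S" "coord.independent B" "S \<subseteq> coord.span B" "card B = coord.dim S"
    using coord.basis_exists by blast
  have sp: "coord.span B = coord.span S"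
    using coord.span_mono[OF B(1)] coord.span_minimal[OF B(3) coord.subspace_span] by (rule equalityI)
  have "finite B" using B assms finite_subset by blast
  have ind: "coord.independent (insert e B)" using False sp B by (simp add: coord.independent_insertI)
  have "coord.span (insert e B) = coord.span (insert e S)"
    using sp by (simp add: coord.span_insert)
  hence "coord.dim (insert e S) = card (insert e B)"
    using coord.span_eq_dim coord.dim_eq_card_independent[OF ind] by metis
  moreover have "e \<notin> B" using False sp coord.span_base by blast
  ultimately show ?thesis using B \<open>finite B\<close> False by simp
qed

interpretation coord_rank: rank_function "coord.dim :: (nat \<Rightarrow> 'k::field) set \<Rightarrow> nat"
proof
  show "coord.dim ({} :: (nat \<Rightarrow> 'k) set) = 0"
    using coord.dim_eq_card_independent[OF coord.independent_empty] by simp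
next
  fix S :: "(nat \<Rightarrow> 'k) set" and e assume "finite S"
  thus "coord.dim (insert e S) = coord.dim S \<or> coord.dim (insert e S) = Suc (coord.dim S)"
    by (simp add: coord_dim_insert)
next
  fix S T :: "(nat \<Rightarrow> 'k) set" and e
  assume *: "finite T" "S \<subseteq> T" "coord.dim (insert e S) = coord.dim S"
  moreover have "finite S" using * finite_subset by blast
  ultimately show "coord.dim (insert e T) = coord.dim T"
    using coord.span_mono[of S T] by (auto simp: coord_dim_insert split: if_splits)
qed

lemma coord_spans_iff: "finite S \<Longrightarrow> coord_rank.spans S e \<longleftrightarrow> e \<in> coord.span S"
  by (simp add: coord_rank.spans_def coord_dim_insert)

lemma span_vanish:
  assumes "x \<in> coord.span S" "\<And>s. s \<in> S \<Longrightarrow> s k = 0"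
  shows "x k = 0"
  using assms(1)
  by (induction rule: coord.span_induct_alt) (auto simp: vscale_def assms(2))

section \<open>Normal vectors of the hyperplanes and their modularity\<close>

definition unit_vec :: "nat \<Rightarrow> nat \<Rightarrow> 'k::field" where
  "unit_vec i = (\<lambda>j. if j = i then 1 else 0)"

lemma sum_unit_vec: "finite C \<Longrightarrow> (\<Sum>j\<in>C. unit_vec i j) = (if i \<in> C then 1 else 0)"
  by (simp add: unit_vec_def)

text \<open>The normal vector of the hyperplane \<open>x i - x j = g * x 0\<close>. Addition of such
  vectors along a path adds the gains.\<close>

definition gain_vec :: "nat \<Rightarrow> nat \<Rightarrow> 'k \<Rightarrow> nat \<Rightarrow> 'k::field" where
  "gain_vec i j g = (\<lambda>k. unit_vec i k - unit_vec j k - g * unit_vec 0 k)"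

lemma gain_vec_swap: "gain_vec j i (- g) = - gain_vec i j g"
  by (auto simp: gain_vec_def fun_eq_iff)

lemma gain_vec_add: "gain_vec i j g + gain_vec j k h = gain_vec i k (g + h)"
  by (auto simp: gain_vec_def fun_eq_iff algebra_simps)

lemma gain_vec_diff: "gain_vec i j g - gain_vec i j h = vscale (h - g) (unit_vec 0)"
  by (auto simp: gain_vec_def fun_eq_iff algebra_simps vscale_def)

lemma gain_vec_refl: "gain_vec i i 0 = 0"
  by (auto simp: gain_vec_def fun_eq_iff)

lemma span_unscale:
  assumes "vscale c x \<in> coord.span S" "c \<noteq> 0"
  shows "x \<in> coord.span S"
proof -
  have "vscale (inverse c) (vscale c x) = x" using assms(2) by (simp add: vscale_def fun_eq_iff)
  thus ?thesis using coord.span_scale[OF assms(1), of "inverse c"] by simp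
qed

text \<open>Two indices are related when the span contains a gain vector joining them. Summing the
  coordinates over a class of this relation is a linear functional that vanishes on the span.\<close>

lemma span_gain_vecs_support:
  fixes S :: "(nat \<Rightarrow> 'k::field) set"
  assumes G: "additive_subgroup G" and P: "finite P" "0 \<notin> P"
    and S: "\<And>s. s \<in> S \<Longrightarrow> \<exists>i\<in>P. \<exists>j\<in>P. \<exists>g\<in>G. s = gain_vec i j g"
    and y: "y \<in> coord.span S" "\<And>k. k \<notin> insert 0 Q \<Longrightarrow> y k = 0"
    and z: "unit_vec 0 \<notin> coord.span S"
    and W: "\<And>i j g. i \<in> P \<inter> Q \<Longrightarrow> j \<in> P \<inter> Q \<Longrightarrow> i \<noteq> j \<Longrightarrow> g \<in> G \<Longrightarrow> gain_vec i j g \<notin> coord.span S"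
  shows "y = 0"
proof -
  define C where "C i = {j \<in> P. \<exists>g\<in>G. gain_vec i j g \<in> coord.span S}" for i
  have Psum: "(\<Sum>j\<in>C i. x j) = 0" if "x \<in> coord.span S" for x i
    using that
  proof (induction rule: coord.span_induct_alt)
    case (step c s x)
    obtain a b g where s: "a \<in> P" "b \<in> P" "g \<in> G" "s = gain_vec a b g" using S[OF step(1)] by blast
    have sp: "gain_vec a b g \<in> coord.span S" using step(1) s coord.span_base by blast
    have sp': "gain_vec b a (- g) \<in> coord.span S" using sp coord.span_neg by (simp add: gain_vec_swap)
    have "a \<in> C i \<longleftrightarrow> b \<in> C i"
    proof
      assume "a \<in> C i"
      then obtain h where h: "h \<in> G" "gain_vec i a h \<in> coord.span S" by (auto simp: C_def)
      from coord.span_add[OF h(2) sp] have "gain_vec i b (h + g) \<in> coord.span S"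
        by (simp only: gain_vec_add)
      moreover have "h + g \<in> G" using G h s by (simp add: additive_subgroup_def)
      ultimately show "b \<in> C i" using s by (auto simp: C_def)
    next
      assume "b \<in> C i"
      then obtain h where h: "h \<in> G" "gain_vec i b h \<in> coord.span S" by (auto simp: C_def)
      from coord.span_add[OF h(2) sp'] have "gain_vec i a (h + - g) \<in> coord.span S"
        by (simp only: gain_vec_add)
      moreover have "h + - g \<in> G" using G h s unfolding additive_subgroup_def by blast
      ultimately show "a \<in> C i" using s by (auto simp: C_def)
    qed
    moreover have "0 \<notin> C i" "finite (C i)" using P by (auto simp: C_def)
    ultimately have "(\<Sum>j\<in>C i. s j) = 0"
      by (simp add: s(4) gain_vec_def sum_subtractf sum_distrib_left[symmetric] sum_unit_vec)
    thus ?case using step(2) by (simp add: vscale_def sum.distrib sum_distrib_left[symmetric])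
  qed simp
  have yP: "y i = 0" if "i \<notin> insert 0 P" for i
  proof (rule span_vanish[OF y(1)])
    fix s assume "s \<in> S"
    then obtain a b g where "a \<in> P" "b \<in> P" "s = gain_vec a b g" using S by blast
    thus "s i = 0" using that by (auto simp: gain_vec_def unit_vec_def)
  qed
  have y0: "y i = 0" if "i \<noteq> 0" for i
  proof (cases "i \<in> P \<inter> Q")
    case True
    have "0 \<in> G" using G by (simp add: additive_subgroup_def)
    hence "i \<in> C i" using True by (auto simp: C_def intro!: bexI[of _ 0] simp: gain_vec_refl coord.span_zero)
    moreover have "finite (C i)" using P by (auto simp: C_def)
    \<comment> \<open>By assumption \<open>W\<close> the class of \<open>i\<close> meets
      \<open>Q\<close> only in \<open>i\<close>, and \<open>y\<close> vanishes on the rest of the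
      class. So the class sum, which is zero, equals \<open>y i\<close>.\<close>
    moreover have "y j = 0" if "j \<in> C i - {i}" for j
    proof -
      have "j \<noteq> i" "j \<in> P" "\<exists>g\<in>G. gain_vec i j g \<in> coord.span S" using that by (auto simp: C_def)
      hence "j \<notin> Q" using W[of i j] True by auto
      thus ?thesis using y(2)[of j] P \<open>j \<in> P\<close> by (metis insertE)
    qed
    ultimately have "(\<Sum>j\<in>C i. y j) = y i" by (simp add: sum.remove)
    thus ?thesis using Psum[OF y(1)] by simp
  next
    case False
    thus ?thesis using y(2)[of i] yP[of i] that by auto
  qed
  have "y = vscale (y 0) (unit_vec 0)" using y0 by (auto simp: vscale_def unit_vec_def fun_eq_iff)
  hence "y 0 = 0" using y(1) z span_unscale[of "y 0" "unit_vec 0" S] by metis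
  thus ?thesis using y0 by (metis ext zero_fun_apply)
qed

text \<open>Write an element \<open>e\<close> of the span of \<open>S \<union> U\<close> as
  \<open>a + b\<close> with \<open>a\<close> from \<open>S\<close> and \<open>b\<close> from
  \<open>U\<close>. Since \<open>e\<close> and \<open>b\<close> are supported on \<open>Q\<close>
  and coordinate 0, so is \<open>a\<close>, and then \<open>a\<close> vanishes by the preceding
  lemma. Thus \<open>S\<close> creates no new dependence among the vectors of
  \<open>Y\<close>.\<close>

lemma modular_over_gain_vecs:
  fixes A :: "(nat \<Rightarrow> 'k::field) set"
  assumes G: "additive_subgroup G" and P: "finite P" "0 \<notin> P" and fin: "finite A" "finite Y"
    and A: "\<And>s. s \<in> A \<Longrightarrow> \<exists>i\<in>P. \<exists>j\<in>P. \<exists>g\<in>G. s = gain_vec i j g"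
    and Y: "\<And>y k. y \<in> Y \<Longrightarrow> k \<notin> insert 0 Q \<Longrightarrow> y k = 0"
    and X: "unit_vec 0 \<in> X"
      "\<And>i j g. i \<in> P \<inter> Q \<Longrightarrow> j \<in> P \<inter> Q \<Longrightarrow> i < j \<Longrightarrow> g \<in> G \<Longrightarrow> gain_vec i j g \<in> X"
  shows "coord_rank.modular_over A Y X"
  unfolding coord_rank.modular_over_def
proof (intro allI impI disjCI)
  fix S T assume S: "S \<subseteq> A" and no: "\<not> (\<forall>T\<subseteq>Y. coord.dim (S \<union> T) = coord.dim S + coord.dim T)"
  show "\<exists>x\<in>X. coord_rank.spans S x"
  proof (rule ccontr)
    assume neg: "\<not> ?thesis"
    have finS: "finite S" using S fin finite_subset by blast
    have nX: "x \<notin> coord.span S" if "x \<in> X" for x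
      using neg that coord_spans_iff[OF finS] by blast
    \<comment> \<open>\<open>X\<close> is only assumed to contain the orientation with increasing
      indices; the other one follows by negation.\<close>
    have nW: "gain_vec i j g \<notin> coord.span S" if "i \<in> P \<inter> Q" "j \<in> P \<inter> Q" "i \<noteq> j" "g \<in> G" for i j g
    proof (cases "i < j")
      case False
      have "- g \<in> G" using that G by (simp add: additive_subgroup_def)
      hence "gain_vec j i (- g) \<notin> coord.span S" using False that by (intro nX X) auto
      thus ?thesis using coord.span_neg by (metis gain_vec_swap)
    qed (use that in \<open>intro nX X\<close>)
    have "coord.dim (S \<union> T) = coord.dim S + coord.dim T" if T: "T \<subseteq> Y" for T
    proof (rule coord_rank.rank_Un_skew[OF finS])
      show finT: "finite T" using T fin finite_subset by blast
      fix U e assume U: "U \<subseteq> T" "e \<in> T" "coord_rank.spans (S \<union> U) e"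
      have "finite U" using U finT finite_subset by blast
      hence "e \<in> coord.span (S \<union> U)" using U finS coord_spans_iff by blast
      then obtain a b where ab: "a \<in> coord.span S" "b \<in> coord.span U" "e = a + b"
        by (auto simp: coord.span_Un)
      have "a k = 0" if "k \<notin> insert 0 Q" for k
      proof -
        have "b k = 0" using U T Y that by (intro span_vanish[OF ab(2)]) blast
        moreover have "e k = 0" using U T Y that by blast
        ultimately show ?thesis using ab(3) by simp
      qed
      moreover have "\<exists>i\<in>P. \<exists>j\<in>P. \<exists>g\<in>G. s = gain_vec i j g" if "s \<in> S" for s
        using that S A by blast
      ultimately have "a = 0"
        using span_gain_vecs_support[OF G P _ ab(1) _ nX[OF X(1)], of Q] nW by simp
      thus "coord_rank.spans U e" using ab coord_spans_iff[OF \<open>finite U\<close>] by simp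
    qed
    thus False using no by blast
  qed
qed

section \<open>Edges, induced subgraphs and their vectors\<close>

lemma gain_edge_eq_iff:
  "gain_edge u v g = gain_edge u' v' g' \<longleftrightarrow> u = u' \<and> v = v' \<and> g = g' \<or> u = v' \<and> v = u' \<and> g = - g'"
  by (auto simp: gain_edge_def doubleton_eq_iff)

lemma gain_edge_swap: "gain_edge v u (- g) = gain_edge u v g"
  by (simp add: gain_edge_eq_iff)

lemma gain_edge_complete_iff:
  assumes "additive_subgroup G"
  shows "gain_edge u v g \<in> edges (complete_gain_graph G W) \<longleftrightarrow> u \<in> W \<and> v \<in> W \<and> u \<noteq> v \<and> g \<in> G"
  using assms by (auto simp: complete_gain_graph_def gain_edge_eq_iff additive_subgroup_def)

lemma loopless_gain_edgeD:
  assumes "loopless_gain_graph \<Gamma>" "gain_edge u v g \<in> edges \<Gamma>"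
  shows "u \<in> verts \<Gamma>" "v \<in> verts \<Gamma>" "u \<noteq> v" "g \<in> gains \<Gamma>"
proof -
  have "additive_subgroup (gains \<Gamma>)" "gain_edge u v g \<in> edges (complete_gain_graph (gains \<Gamma>) (verts \<Gamma>))"
    using assms unfolding loopless_gain_graph_def by auto
  thus "u \<in> verts \<Gamma>" "v \<in> verts \<Gamma>" "u \<noteq> v" "g \<in> gains \<Gamma>"
    by (auto simp: gain_edge_complete_iff)
qed

lemma gain_edge_induced_iff:
  "gain_edge u v g \<in> edges (induced \<Gamma> W) \<longleftrightarrow> gain_edge u v g \<in> edges \<Gamma> \<and> u \<in> W \<and> v \<in> W"
  by (auto simp: induced_def gain_edge_eq_iff)

lemma induced_induced: "W \<subseteq> V \<Longrightarrow> induced (induced \<Gamma> V) W = induced \<Gamma> W"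
  by (auto simp: induced_def gain_edge_eq_iff)

lemma loopless_induced:
  assumes "loopless_gain_graph \<Gamma>" "W \<subseteq> verts \<Gamma>"
  shows "loopless_gain_graph (induced \<Gamma> W)"
proof -
  have "edges (induced \<Gamma> W) \<subseteq> edges (complete_gain_graph (gains \<Gamma>) W)"
  proof
    fix e assume e: "e \<in> edges (induced \<Gamma> W)"
    then obtain u v g where "e = gain_edge u v g" by (auto simp: induced_def)
    thus "e \<in> edges (complete_gain_graph (gains \<Gamma>) W)"
      using e assms loopless_gain_edgeD[OF assms(1), of u v g]
      by (auto simp: gain_edge_induced_iff gain_edge_complete_iff loopless_gain_graph_def)
  qed
  thus ?thesis using assms finite_subset[OF assms(2)]
    by (auto simp: loopless_gain_graph_def induced_def)
qed

text \<open>Only the orientation with increasing labels is taken, so that no two of the vectors are parallel.\<close>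

definition gain_vectors :: "('v \<Rightarrow> nat) \<Rightarrow> ('v, 'k::field) gain_graph \<Rightarrow> (nat \<Rightarrow> 'k) set" where
  "gain_vectors l \<Gamma> = insert (unit_vec 0)
    {gain_vec (l u) (l v) g | u v g. gain_edge u v g \<in> edges \<Gamma> \<and> l u < l v}"

lemma gain_vectors_cases:
  assumes "x \<in> gain_vectors l \<Gamma>"
  obtains "x = unit_vec 0"
  | u v g where "x = gain_vec (l u) (l v) g" "gain_edge u v g \<in> edges \<Gamma>" "l u < l v"
  using assms by (auto simp: gain_vectors_def)

lemma finite_gain_vectors:
  assumes "loopless_gain_graph \<Gamma>"
  shows "finite (gain_vectors l \<Gamma>)"
proof -
  have "finite e" if "e \<in> edges \<Gamma>" for e
    using that assms by (auto simp: loopless_gain_graph_def complete_gain_graph_def gain_edge_def)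
  hence "finite ((\<lambda>(u, v, g). gain_vec (l u) (l v) g) ` \<Union>(edges \<Gamma>))"
    using assms by (auto simp: loopless_gain_graph_def)
  moreover have "gain_vec (l u) (l v) g \<in> (\<lambda>(u, v, g). gain_vec (l u) (l v) g) ` \<Union>(edges \<Gamma>)"
    if "gain_edge u v g \<in> edges \<Gamma>" for u v g
    using that by (intro image_eqI[of _ _ "(u, v, g)"]) (auto simp: gain_edge_def)
  hence "gain_vectors l \<Gamma> \<subseteq> insert (unit_vec 0) ((\<lambda>(u, v, g). gain_vec (l u) (l v) g) ` \<Union>(edges \<Gamma>))"
    by (auto simp: gain_vectors_def)
  ultimately show ?thesis by (meson finite_insert finite_subset)
qed

lemma gain_vectors_support:
  assumes "loopless_gain_graph \<Gamma>" "x \<in> gain_vectors l \<Gamma>" "k \<notin> insert 0 (l ` verts \<Gamma>)"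
  shows "x k = 0"
  using assms(2)
proof (cases rule: gain_vectors_cases)
  case (2 u v g)
  thus ?thesis using assms loopless_gain_edgeD[OF assms(1) 2(2)]
    by (auto simp: gain_vec_def unit_vec_def)
qed (use assms in \<open>auto simp: unit_vec_def\<close>)

lemma gain_vec_mem_gain_vectors:
  assumes "gain_edge u v g \<in> edges \<Gamma>" "l u \<noteq> l v"
  shows "gain_vec (l u) (l v) g \<in> gain_vectors l \<Gamma> \<or> - gain_vec (l u) (l v) g \<in> gain_vectors l \<Gamma>"
proof (cases "l u < l v")
  case False
  hence "gain_vec (l v) (l u) (- g) \<in> gain_vectors l \<Gamma>"
    using assms unfolding gain_vectors_def
    by (intro insertI2 CollectI exI[of _ v] exI[of _ u] exI[of _ "- g"]) (auto simp: gain_edge_swap)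
  thus ?thesis by (simp add: gain_vec_swap)
qed (use assms in \<open>auto simp: gain_vectors_def\<close>)

text \<open>What an induced subgraph inherits from a labeling: the labels need no longer form an
  initial segment, but index 0 stays reserved for the coordinate of z.\<close>

definition embeds :: "('v \<Rightarrow> nat) \<Rightarrow> 'v set \<Rightarrow> bool" where
  "embeds l V \<longleftrightarrow> inj_on l V \<and> 0 \<notin> l ` V"

lemma gain_vec_nonzero: "i < j \<Longrightarrow> gain_vec i j g \<noteq> 0"
  by (auto simp: gain_vec_def unit_vec_def fun_eq_iff intro!: exI[of _ j])

lemma gain_vec_apply:
  assumes "0 < i" "i < j"
  shows "gain_vec i j g k = (if k = 0 then - g else if k = i then 1 else if k = j then - 1 else 0)"
  using assms by (auto simp: gain_vec_def unit_vec_def)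

text \<open>The nonzero entries away from index 0 give the endpoints, the order of the indices
  excludes a swap, and entry \<open>i\<close> forces \<open>c = 1\<close>. Entry 0 then compares the
  gains.\<close>

lemma gain_vec_scale_eqD:
  assumes "gain_vec i j g = vscale c (gain_vec i' j' g')" "0 < i" "i < j" "0 < i'" "i' < j'"
  shows "i = i' \<and> j = j' \<and> g = g'"
proof -
  have eq: "gain_vec i j g k = c * gain_vec i' j' g' k" for k
    using assms(1) by (simp add: vscale_def)
  note app = gain_vec_apply[OF assms(2,3)] gain_vec_apply[OF assms(4,5)]
  have "i = i' \<or> i = j'" using eq[of i] assms(2-) unfolding app by (auto split: if_splits)
  moreover have "j = i' \<or> j = j'" using eq[of j] assms(2-) unfolding app by (auto split: if_splits)
  ultimately have ij: "i = i'" "j = j'" using assms(3,5) by auto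
  have "c = 1" using eq[of i] assms(2-) ij unfolding app by simp
  thus ?thesis using ij eq[of 0] unfolding app by simp
qed

lemma gain_vec_unit_vec_not_parallel:
  assumes "0 < i" "i < j"
  shows "gain_vec i j g \<noteq> vscale c (unit_vec 0)" "unit_vec 0 \<noteq> vscale c (gain_vec i j g)"
proof -
  note app = gain_vec_apply[OF assms]
  show ne: "gain_vec i j g \<noteq> vscale c (unit_vec 0)" for c
  proof
    assume "gain_vec i j g = vscale c (unit_vec 0)"
    hence "gain_vec i j g j = c * unit_vec 0 j" by (simp add: vscale_def)
    thus False using assms unfolding app by (simp add: unit_vec_def)
  qed
  show "unit_vec 0 \<noteq> vscale c (gain_vec i j g)"
  proof
    assume *: "unit_vec 0 = vscale c (gain_vec i j g)"
    hence "unit_vec 0 j = c * gain_vec i j g j" by (simp add: vscale_def)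
    hence "c = 0" using assms unfolding app by (simp add: unit_vec_def)
    hence "unit_vec 0 (0::nat) = (0::'a)" unfolding * by (simp add: vscale_def)
    thus False by (simp add: unit_vec_def)
  qed
qed

lemma gain_vectors_simple:
  fixes \<Gamma> :: "('v, 'k::field) gain_graph"
  assumes l: "embeds l (verts \<Gamma>)" and \<Gamma>: "loopless_gain_graph \<Gamma>"
    and "a \<in> gain_vectors l \<Gamma>" "b \<in> gain_vectors l \<Gamma>" "b \<in> coord.span {a}"
  shows "a = b"
proof -
  obtain c where c: "b = vscale c a" using assms(5) by (auto simp: coord.span_singleton)
  have pos: "0 < l u" if "gain_edge u v g \<in> edges \<Gamma>" for u v g
    using loopless_gain_edgeD[OF \<Gamma> that] l by (auto simp: embeds_def image_iff)
  show ?thesis using assms(3)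
  proof (cases rule: gain_vectors_cases)
    case a: 1
    show ?thesis using assms(4)
    proof (cases rule: gain_vectors_cases)
      case b: (2 u v g)
      thus ?thesis using gain_vec_unit_vec_not_parallel(1)[OF pos[OF b(2)] b(3)] a c by metis
    qed (simp add: a)
  next
    case a: (2 u v g)
    show ?thesis using assms(4)
    proof (cases rule: gain_vectors_cases)
      case b: 1
      thus ?thesis using gain_vec_unit_vec_not_parallel(2)[OF pos[OF a(2)] a(3)] a c by metis
    next
      case b: (2 u' v' g')
      have "gain_vec (l u') (l v') g' = vscale c (gain_vec (l u) (l v) g)" using a(1) b(1) c by simp
      from gain_vec_scale_eqD[OF this pos[OF b(2)] b(3) pos[OF a(2)] a(3)] a b show ?thesis by simp
    qed
  qed
qed

lemma gain_vectors_nonloop: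
  fixes \<Gamma> :: "('v, 'k::field) gain_graph"
  assumes "a \<in> gain_vectors l \<Gamma>"
  shows "coord.dim {a} = 1"
proof -
  have "(unit_vec 0 :: nat \<Rightarrow> 'k) 0 \<noteq> 0" by (simp add: unit_vec_def)
  hence "(unit_vec 0 :: nat \<Rightarrow> 'k) \<noteq> 0" by (metis zero_fun_apply)
  with assms have "a \<noteq> 0" by (cases rule: gain_vectors_cases) (auto simp: gain_vec_nonzero)
  thus ?thesis using coord_dim_insert[of "{}" a] coord_rank.rank_empty by simp
qed

section \<open>Chains for gain graphs\<close>

definition gain_full :: "('v, 'g::group_add) gain_graph \<Rightarrow> 'v set \<Rightarrow> bool" where
  "gain_full \<Gamma> W \<longleftrightarrow> W \<subseteq> verts \<Gamma> \<and>
    (\<forall>u\<in>W. \<forall>w\<in>W. u \<noteq> w \<longrightarrow> (\<forall>g\<in>gains \<Gamma>. gain_edge u w g \<in> edges \<Gamma>))"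

lemma gain_full_induced_iff: "W \<subseteq> V \<Longrightarrow> V \<subseteq> verts \<Gamma> \<Longrightarrow> gain_full (induced \<Gamma> V) W \<longleftrightarrow> gain_full \<Gamma> W"
  by (auto simp: gain_full_def gain_edge_induced_iff) (auto simp: induced_def)

lemma embeds_subset: "embeds l V \<Longrightarrow> W \<subseteq> V \<Longrightarrow> embeds l W"
  unfolding embeds_def by (blast intro: inj_on_subset)

lemma gain_vectors_induced_subset: "gain_vectors l (induced \<Gamma> W) \<subseteq> gain_vectors l \<Gamma>"
  by (auto simp: gain_vectors_def gain_edge_induced_iff)

lemma gain_vec_mem_induced:
  assumes "gain_edge u v g \<in> edges \<Gamma>" "l u < l v" "u \<in> W" "v \<in> W"
  shows "gain_vec (l u) (l v) g \<in> gain_vectors l (induced \<Gamma> W)"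
  using assms by (auto simp: gain_vectors_def gain_edge_induced_iff)

lemma gain_vec_mem_inducedD:
  assumes l: "embeds l (verts \<Gamma>)" and \<Gamma>: "loopless_gain_graph \<Gamma>"
    and e: "gain_edge u v g \<in> edges \<Gamma>" "l u < l v"
    and mem: "gain_vec (l u) (l v) g \<in> gain_vectors l (induced \<Gamma> W)"
  shows "u \<in> W \<and> v \<in> W"
proof -
  have pos: "0 < l u" if "gain_edge u v g \<in> edges \<Gamma>" for u v g
    using loopless_gain_edgeD[OF \<Gamma> that] l by (auto simp: embeds_def image_iff)
  show ?thesis using mem
  proof (cases rule: gain_vectors_cases)
    case 1
    hence "gain_vec (l u) (l v) g = vscale 1 (unit_vec 0)" by (simp add: vscale_def)
    thus ?thesis using gain_vec_unit_vec_not_parallel(1)[OF pos[OF e(1)] e(2)] by blast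
  next
    case (2 u' v' g')
    hence e': "gain_edge u' v' g' \<in> edges \<Gamma>" "u' \<in> W" "v' \<in> W" by (auto simp: gain_edge_induced_iff)
    have "gain_vec (l u) (l v) g = vscale 1 (gain_vec (l u') (l v') g')"
      using 2(1) by (simp add: vscale_def)
    from gain_vec_scale_eqD[OF this pos[OF e(1)] e(2) pos[OF e'(1)] 2(3)]
    have "l u = l u'" "l v = l v'" by auto
    hence "u = u'" "v = v'"
      using l loopless_gain_edgeD[OF \<Gamma> e(1)] loopless_gain_edgeD[OF \<Gamma> e'(1)]
      by (auto simp: embeds_def inj_on_def)
    thus ?thesis using e' by simp
  qed
qed

lemma gain_vectors_Int_induced:
  assumes "embeds l (verts \<Gamma>)" "loopless_gain_graph \<Gamma>"
  shows "gain_vectors l (induced \<Gamma> V) \<inter> gain_vectors l (induced \<Gamma> W) =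
    gain_vectors l (induced \<Gamma> (V \<inter> W))"
proof
  show "gain_vectors l (induced \<Gamma> V) \<inter> gain_vectors l (induced \<Gamma> W) \<subseteq> gain_vectors l (induced \<Gamma> (V \<inter> W))"
  proof
    fix x assume x: "x \<in> gain_vectors l (induced \<Gamma> V) \<inter> gain_vectors l (induced \<Gamma> W)"
    hence "x \<in> gain_vectors l (induced \<Gamma> V)" by simp
    thus "x \<in> gain_vectors l (induced \<Gamma> (V \<inter> W))"
    proof (cases rule: gain_vectors_cases)
      case (2 u v g)
      thus ?thesis using gain_vec_mem_inducedD[OF assms, of u v g W] x
        by (auto simp: gain_edge_induced_iff intro!: gain_vec_mem_induced)
    qed (simp add: gain_vectors_def)
  qed
qed (auto simp: gain_vectors_def gain_edge_induced_iff)

lemma gain_vectors_glue: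
  assumes cover: "\<And>u v g. gain_edge u v g \<in> edges \<Gamma> \<Longrightarrow> u \<in> V1 \<and> v \<in> V1 \<or> u \<in> V2 \<and> v \<in> V2"
  shows "gain_vectors l \<Gamma> = gain_vectors l (induced \<Gamma> V1) \<union> gain_vectors l (induced \<Gamma> V2)"
  using cover by (auto simp: gain_vectors_def gain_edge_induced_iff) blast

text \<open>The common labels of the two parts are those of \<open>V1 \<inter> V2\<close>, and
  fullness says that all gain vectors on them belong to the intersection. Removing the intersection
  also removes \<open>unit_vec 0\<close>, so that only gain vectors remain on the left.\<close>

lemma modular_over_glue:
  fixes \<Gamma> :: "('v, 'k::field) gain_graph"
  assumes l: "embeds l (verts \<Gamma>)" and \<Gamma>: "loopless_gain_graph \<Gamma>"
    and V: "V1 \<subseteq> verts \<Gamma>" "V2 \<subseteq> verts \<Gamma>" and full: "gain_full \<Gamma> (V1 \<inter> V2)"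
  shows "coord_rank.modular_over (gain_vectors l (induced \<Gamma> V1) - gain_vectors l (induced \<Gamma> (V1 \<inter> V2)))
    (gain_vectors l (induced \<Gamma> V2)) (gain_vectors l (induced \<Gamma> (V1 \<inter> V2)))"
proof (rule modular_over_gain_vecs[where G = "gains \<Gamma>" and P = "l ` V1" and Q = "l ` V2"])
  have \<Gamma>1: "loopless_gain_graph (induced \<Gamma> V1)" and \<Gamma>2: "loopless_gain_graph (induced \<Gamma> V2)"
    using loopless_induced \<Gamma> V by blast+
  show "finite (gain_vectors l (induced \<Gamma> V1) - gain_vectors l (induced \<Gamma> (V1 \<inter> V2)))"
    "finite (gain_vectors l (induced \<Gamma> V2))"
    using finite_gain_vectors \<Gamma>1 \<Gamma>2 by blast+
  show "additive_subgroup (gains \<Gamma>)" using \<Gamma> by (simp add: loopless_gain_graph_def)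
  show "finite (l ` V1)" using V(1) \<Gamma> finite_subset finite_imageI unfolding loopless_gain_graph_def by blast
  show "0 \<notin> l ` V1" using V l by (auto simp: embeds_def)
  show "unit_vec 0 \<in> gain_vectors l (induced \<Gamma> (V1 \<inter> V2))" by (simp add: gain_vectors_def)
  show "y k = 0" if "y \<in> gain_vectors l (induced \<Gamma> V2)" "k \<notin> insert 0 (l ` V2)" for y k
    using gain_vectors_support[OF \<Gamma>2 that(1)] that(2) by (simp add: induced_def)
next
  fix s assume s: "s \<in> gain_vectors l (induced \<Gamma> V1) - gain_vectors l (induced \<Gamma> (V1 \<inter> V2))"
  hence "s \<in> gain_vectors l (induced \<Gamma> V1)" by simp
  thus "\<exists>i\<in>l ` V1. \<exists>j\<in>l ` V1. \<exists>g\<in>gains \<Gamma>. s = gain_vec i j g"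
  proof (cases rule: gain_vectors_cases)
    case 1
    thus ?thesis using s by (simp add: gain_vectors_def)
  next
    case (2 u v g)
    hence "gain_edge u v g \<in> edges \<Gamma>" "u \<in> V1" "v \<in> V1" by (auto simp: gain_edge_induced_iff)
    thus ?thesis using loopless_gain_edgeD[OF \<Gamma>, of u v g] 2 by blast
  qed
next
  fix i j g assume *: "i \<in> l ` V1 \<inter> l ` V2" "j \<in> l ` V1 \<inter> l ` V2" "i < j" "g \<in> gains \<Gamma>"
  have "l ` V1 \<inter> l ` V2 = l ` (V1 \<inter> V2)"
    using l V by (intro inj_on_image_Int[symmetric, of _ "verts \<Gamma>"]) (auto simp: embeds_def)
  then obtain u v where uv: "i = l u" "j = l v" "u \<in> V1 \<inter> V2" "v \<in> V1 \<inter> V2" using * by blast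
  moreover have "u \<noteq> v" using uv * by auto
  ultimately have "gain_edge u v g \<in> edges \<Gamma>" using * full by (auto simp: gain_full_def)
  thus "gain_vec i j g \<in> gain_vectors l (induced \<Gamma> (V1 \<inter> V2))"
    using uv * by (auto intro!: gain_vec_mem_induced)
qed

definition has_chain :: "('v \<Rightarrow> nat) \<Rightarrow> ('v, 'k::field) gain_graph \<Rightarrow> ('v, 'k) gain_graph \<Rightarrow> bool" where
  "has_chain l \<Gamma> \<Delta> \<longleftrightarrow>
    (\<exists>F m. coord_rank.divisional_chain (gain_vectors l \<Gamma>) (gain_vectors l \<Delta>) F m)"

lemma has_chain_glue:
  fixes \<Gamma> :: "('v, 'k::field) gain_graph"
  assumes l: "embeds l (verts \<Gamma>)" and \<Gamma>: "loopless_gain_graph \<Gamma>"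
    and V: "V1 \<subseteq> verts \<Gamma>" "V2 \<subseteq> verts \<Gamma>" and full: "gain_full \<Gamma> (V1 \<inter> V2)"
    and cover: "\<And>u v g. gain_edge u v g \<in> edges \<Gamma> \<Longrightarrow> u \<in> V1 \<and> v \<in> V1 \<or> u \<in> V2 \<and> v \<in> V2"
    and chain: "has_chain l (induced \<Gamma> V1) (induced \<Gamma> (V1 \<inter> V2))"
  shows "has_chain l \<Gamma> (induced \<Gamma> V2)"
proof -
  obtain F m where "coord_rank.divisional_chain (gain_vectors l (induced \<Gamma> V1))
      (gain_vectors l (induced \<Gamma> (V1 \<inter> V2))) F m"
    using chain by (auto simp: has_chain_def)
  hence "coord_rank.divisional_chain (gain_vectors l (induced \<Gamma> V1) \<union> gain_vectors l (induced \<Gamma> V2))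
      (gain_vectors l (induced \<Gamma> V2)) F m"
    using finite_gain_vectors[OF loopless_induced[OF \<Gamma> V(1)]]
      finite_gain_vectors[OF loopless_induced[OF \<Gamma> V(2)]] gain_vectors_Int_induced[OF l \<Gamma>]
      modular_over_glue[OF l \<Gamma> V full]
    by (intro coord_rank.divisional_chain_glue[OF _ _ _ gain_vectors_nonloop]) simp_all
  moreover have "gain_vectors l \<Gamma> = gain_vectors l (induced \<Gamma> V1) \<union> gain_vectors l (induced \<Gamma> V2)"
    using cover by (rule gain_vectors_glue)
  ultimately show ?thesis by (auto simp: has_chain_def)
qed

text \<open>The chain of the part \<open>V1\<close> leads to a complement of \<open>V2\<close>, and
  the chain of \<open>V2\<close> continues it. The vectors of \<open>V2\<close> are modular because
  a spanned element of the intersection is in particular one of \<open>V2\<close>.\<close>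

lemma has_chain_glue_trans:
  fixes \<Gamma> :: "('v, 'k::field) gain_graph"
  assumes l: "embeds l (verts \<Gamma>)" and \<Gamma>: "loopless_gain_graph \<Gamma>"
    and V: "V1 \<subseteq> verts \<Gamma>" "V2 \<subseteq> verts \<Gamma>" and full: "gain_full \<Gamma> (V1 \<inter> V2)"
    and cover: "\<And>u v g. gain_edge u v g \<in> edges \<Gamma> \<Longrightarrow> u \<in> V1 \<and> v \<in> V1 \<or> u \<in> V2 \<and> v \<in> V2"
    and chain: "has_chain l (induced \<Gamma> V1) (induced \<Gamma> (V1 \<inter> V2))"
    and W: "W \<subseteq> V2" and chain': "has_chain l (induced \<Gamma> V2) (induced \<Gamma> W)"
  shows "has_chain l \<Gamma> (induced \<Gamma> W)"
proof -
  let ?Y = "gain_vectors l (induced \<Gamma> V2)"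
  have "has_chain l \<Gamma> (induced \<Gamma> V2)" by (rule has_chain_glue[OF l \<Gamma> V full cover chain])
  then obtain F m G k where F: "coord_rank.divisional_chain (gain_vectors l \<Gamma>) ?Y F m"
    and G: "coord_rank.divisional_chain ?Y (gain_vectors l (induced \<Gamma> W)) G k"
    using chain' by (auto simp: has_chain_def)
  have sub: "gain_vectors l (induced \<Gamma> W) \<subseteq> ?Y"
    using gain_vectors_induced_subset[of l "induced \<Gamma> V2" W] W by (simp add: induced_induced)
  have "gain_vectors l \<Gamma> = gain_vectors l (induced \<Gamma> V1) \<union> ?Y"
    using cover by (rule gain_vectors_glue)
  hence "gain_vectors l \<Gamma> - ?Y = gain_vectors l (induced \<Gamma> V1) - gain_vectors l (induced \<Gamma> (V1 \<inter> V2))"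
    using gain_vectors_Int_induced[OF l \<Gamma>, of V1 V2] by blast
  hence "coord_rank.modular_over (gain_vectors l \<Gamma> - ?Y) ?Y ?Y"
    using coord_rank.modular_over_mono[OF modular_over_glue[OF l \<Gamma> V full], of ?Y ?Y]
      gain_vectors_Int_induced[OF l \<Gamma>, of V1 V2] by auto
  from coord_rank.divisional_chain_trans[OF finite_gain_vectors[OF \<Gamma>] gain_vectors_induced_subset sub this F G]
  show ?thesis unfolding has_chain_def by blast
qed

section \<open>Edges at a link-simplicial vertex\<close>

text \<open>The vectors lost by deleting \<open>v\<close> come from edges at \<open>v\<close>. The
  sign allows every such edge to be read as starting at \<open>v\<close>, although the vectors are
  oriented by labels.\<close>

lemma star_vector_cases:
  fixes \<Gamma> :: "('v, 'k::field) gain_graph"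
  assumes \<Gamma>: "loopless_gain_graph \<Gamma>"
    and s: "s \<in> gain_vectors l \<Gamma> - gain_vectors l (induced \<Gamma> (verts \<Gamma> - {v}))"
  obtains u g where "gain_edge v u g \<in> edges \<Gamma>" "s = gain_vec (l v) (l u) g \<or> s = - gain_vec (l v) (l u) g"
proof -
  have "s \<in> gain_vectors l \<Gamma>" using s by simp
  thus ?thesis
  proof (cases rule: gain_vectors_cases)
    case 1
    thus ?thesis using s by (simp add: gain_vectors_def)
  next
    case (2 a b g)
    have "a = v \<or> b = v"
    proof (rule ccontr)
      assume "\<not> ?thesis"
      hence "gain_vec (l a) (l b) g \<in> gain_vectors l (induced \<Gamma> (verts \<Gamma> - {v}))"
        using loopless_gain_edgeD[OF \<Gamma> 2(2)] by (intro gain_vec_mem_induced 2) auto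
      thus False using s 2(1) by simp
    qed
    thus ?thesis
    proof
      assume "b = v"
      hence "gain_edge v a (- g) \<in> edges \<Gamma>" "s = - gain_vec (l v) (l a) (- g)"
        using 2 gain_vec_swap[of "l v" "l a" g] by (simp_all add: gain_edge_swap)
      thus ?thesis using that by blast
    qed (use 2 that in blast)
  qed
qed

lemma span_minus_iff: "- x \<in> coord.span S \<longleftrightarrow> x \<in> coord.span S"
  by (metis coord.span_neg minus_minus)

text \<open>The line through two edges at \<open>v\<close> meets the graph without \<open>v\<close>.
  Edges to the same neighbour differ by a multiple of \<open>unit_vec 0\<close>; edges to distinct
  neighbours differ, up to sign, by the edge that link-simpliciality provides.\<close>

lemma star_vectors_span:
  fixes \<Gamma> :: "('v, 'k::field) gain_graph"
  assumes l: "embeds l (verts \<Gamma>)" and \<Gamma>: "loopless_gain_graph \<Gamma>" and v: "link_simplicial \<Gamma> v"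
    and s: "s \<in> gain_vectors l \<Gamma> - gain_vectors l (induced \<Gamma> (verts \<Gamma> - {v}))"
    and t: "t \<in> gain_vectors l \<Gamma> - gain_vectors l (induced \<Gamma> (verts \<Gamma> - {v}))" and "s \<noteq> t"
    and S: "s \<in> coord.span S" "t \<in> coord.span S"
  shows "\<exists>p\<in>gain_vectors l (induced \<Gamma> (verts \<Gamma> - {v})). p \<in> coord.span S"
proof -
  obtain u g where u: "gain_edge v u g \<in> edges \<Gamma>" "s = gain_vec (l v) (l u) g \<or> s = - gain_vec (l v) (l u) g"
    by (rule star_vector_cases[OF \<Gamma> s])
  obtain w h where w: "gain_edge v w h \<in> edges \<Gamma>" "t = gain_vec (l v) (l w) h \<or> t = - gain_vec (l v) (l w) h"
    by (rule star_vector_cases[OF \<Gamma> t])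
  have sp: "gain_vec (l v) (l u) g \<in> coord.span S" "gain_vec (l v) (l w) h \<in> coord.span S"
    using u w S span_minus_iff by metis+
  show ?thesis
  proof (cases "u = w")
    case True
    \<comment> \<open>With equal gains, \<open>s\<close> and \<open>t\<close> would agree up to sign
      and hence be equal by simplicity.\<close>
    have "g \<noteq> h"
    proof
      assume "g = h"
      hence "s = t \<or> s = - t" using u w True by auto
      hence "t \<in> coord.span {s}" using coord.span_base[of s "{s}"] span_minus_iff[of t "{s}"] by auto
      thus False using gain_vectors_simple[OF l \<Gamma>, of s t] s t \<open>s \<noteq> t\<close> by simp
    qed
    have "vscale (h - g) (unit_vec 0) \<in> coord.span S"
      using coord.span_diff[OF sp] True by (simp add: gain_vec_diff)
    hence "unit_vec 0 \<in> coord.span S" using \<open>g \<noteq> h\<close> span_unscale by (metis eq_iff_diff_eq_0)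
    moreover have "unit_vec 0 \<in> gain_vectors l (induced \<Gamma> (verts \<Gamma> - {v}))" by (simp add: gain_vectors_def)
    ultimately show ?thesis by blast
  next
    case False
    have "gain_edge u v (- g) \<in> edges \<Gamma>" using u by (simp add: gain_edge_swap)
    hence e: "gain_edge u w (- g + h) \<in> edges \<Gamma>"
      using v w False unfolding link_simplicial_def by blast
    have uw: "u \<in> verts \<Gamma> - {v}" "w \<in> verts \<Gamma> - {v}"
      using loopless_gain_edgeD[OF \<Gamma> u(1)] loopless_gain_edgeD[OF \<Gamma> w(1)] by auto
    hence "l u \<noteq> l w" using l False by (auto simp: embeds_def inj_on_def)
    moreover have "gain_edge u w (- g + h) \<in> edges (induced \<Gamma> (verts \<Gamma> - {v}))"
      using e uw by (simp add: gain_edge_induced_iff)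
    ultimately have mem: "gain_vec (l u) (l w) (- g + h) \<in> gain_vectors l (induced \<Gamma> (verts \<Gamma> - {v})) \<or>
        - gain_vec (l u) (l w) (- g + h) \<in> gain_vectors l (induced \<Gamma> (verts \<Gamma> - {v}))"
      by (intro gain_vec_mem_gain_vectors)
    have "gain_vec (l u) (l v) (- g) \<in> coord.span S" using sp(1) by (simp add: gain_vec_swap span_minus_iff)
    hence "gain_vec (l u) (l w) (- g + h) \<in> coord.span S"
      using coord.span_add[OF _ sp(2)] gain_vec_add by metis
    thus ?thesis using mem span_minus_iff by blast
  qed
qed

text \<open>Coordinate \<open>l v\<close> vanishes on all vectors of a graph without
  \<open>v\<close>, but not on \<open>s\<close>.\<close>

lemma star_vector_not_in_span:
  fixes \<Gamma> :: "('v, 'k::field) gain_graph"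
  assumes l: "embeds l (verts \<Gamma>)" and \<Gamma>: "loopless_gain_graph \<Gamma>" and V: "V \<subseteq> verts \<Gamma> - {v}" and v: "v \<in> verts \<Gamma>"
    and s: "s = gain_vec (l v) (l u) g \<or> s = - gain_vec (l v) (l u) g" and u: "u \<in> verts \<Gamma>" "u \<noteq> v"
    and T: "T \<subseteq> gain_vectors l (induced \<Gamma> V)"
  shows "s \<notin> coord.span T"
proof
  assume "s \<in> coord.span T"
  moreover have "t (l v) = 0" if "t \<in> T" for t
  proof (rule gain_vectors_support)
    show "t \<in> gain_vectors l (induced \<Gamma> V)" using T that by blast
    show "loopless_gain_graph (induced \<Gamma> V)" using V by (intro loopless_induced[OF \<Gamma>]) blast
    show "l v \<notin> insert 0 (l ` verts (induced \<Gamma> V))"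
      using l V v by (auto simp: embeds_def induced_def inj_on_def image_iff)
  qed
  ultimately have "s (l v) = 0" by (rule span_vanish)
  moreover have "l v \<noteq> l u" "l v \<noteq> 0" using l u v by (auto simp: embeds_def inj_on_def image_iff)
  ultimately show False using s by (auto simp: gain_vec_def unit_vec_def)
qed

text \<open>Deleting \<open>v\<close> leaves a modular flat, of corank one if \<open>v\<close> has
  an edge. Two distinct edges at \<open>v\<close> span an element of \<open>E'\<close> by
  \<open>star_vectors_span\<close>; a single one is skew to \<open>E'\<close> by its coordinate at
  \<open>v\<close>.\<close>

lemma modular_over_link_simplicial:
  fixes \<Gamma> :: "('v, 'k::field) gain_graph"
  assumes l: "embeds l (verts \<Gamma>)" and \<Gamma>: "loopless_gain_graph \<Gamma>" and v: "link_simplicial \<Gamma> v"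
  defines "E \<equiv> gain_vectors l \<Gamma>" and "E' \<equiv> gain_vectors l (induced \<Gamma> (verts \<Gamma> - {v}))"
  shows "coord_rank.modular_over (E - E') E' E'"
    and "s \<in> E - E' \<Longrightarrow> coord.dim E = Suc (coord.dim E')"
proof -
  have fin: "finite E" "finite E'"
    unfolding E_def E'_def using \<Gamma> loopless_induced by (intro finite_gain_vectors; blast)+
  have sub: "E' \<subseteq> E" unfolding E_def E'_def by (rule gain_vectors_induced_subset)
  have out: "s \<notin> coord.span T" if s: "s \<in> E - E'" and T: "T \<subseteq> E'" for s T
  proof -
    obtain u g where u: "gain_edge v u g \<in> edges \<Gamma>" "s = gain_vec (l v) (l u) g \<or> s = - gain_vec (l v) (l u) g"
      by (rule star_vector_cases[OF \<Gamma> s[unfolded E_def E'_def]])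
    show ?thesis
      using star_vector_not_in_span[OF l \<Gamma> order_refl _ u(2)] loopless_gain_edgeD[OF \<Gamma> u(1)] T
      by (auto simp: E'_def)
  qed
  show "coord_rank.modular_over (E - E') E' E'"
    unfolding coord_rank.modular_over_def
  proof (intro allI impI disjCI)
    fix S T assume S: "S \<subseteq> E - E'" and *: "\<not> (\<forall>T\<subseteq>E'. coord.dim (S \<union> T) = coord.dim S + coord.dim T)"
    have finS: "finite S" using S fin finite_subset by blast
    have "\<exists>s\<in>S. \<exists>t\<in>S. s \<noteq> t"
    proof (rule ccontr)
      assume no: "\<not> ?thesis"
      have "coord.dim (S \<union> T) = coord.dim S + coord.dim T" if T: "T \<subseteq> E'" for T
      proof (cases "S = {}")
        case False
        then obtain s where s: "S = {s}" using no by blast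
        have "finite T" using T fin finite_subset by blast
        thus ?thesis using out[of s T] out[of s "{}"] T S s
          coord_dim_insert[of T s] coord_dim_insert[of "{}" s] coord_rank.rank_empty by simp
      qed (simp add: coord_rank.rank_empty)
      thus False using * by blast
    qed
    then obtain s t where st: "s \<in> S" "t \<in> S" "s \<noteq> t" by blast
    hence "\<exists>p\<in>E'. p \<in> coord.span S"
      using star_vectors_span[OF l \<Gamma> v, of s t S] S coord.span_base by (auto simp: E_def E'_def)
    thus "\<exists>x\<in>E'. coord_rank.spans S x" using coord_spans_iff[OF finS] by blast
  qed
  show "coord.dim E = Suc (coord.dim E')" if s: "s \<in> E - E'" for s
  proof -
    have "t \<in> coord.span (insert s E')" if t: "t \<in> E" for t
    proof (cases "t \<in> E' \<or> t = s")
      case False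
      moreover have "s \<in> coord.span {s, t}" "t \<in> coord.span {s, t}" by (simp_all add: coord.span_base)
      ultimately obtain p where p: "p \<in> E'" "p \<in> coord.span {s, t}"
        using star_vectors_span[OF l \<Gamma> v, of s t "{s, t}"] s t by (auto simp: E_def E'_def)
      \<comment> \<open>Exchange on the line through \<open>s\<close> and \<open>t\<close>: its
        point \<open>p\<close> is not parallel to \<open>s\<close>, so \<open>p\<close> and
        \<open>s\<close> span \<open>t\<close>.\<close>
      have "p \<notin> coord.span {s}"
        using gain_vectors_simple[OF l \<Gamma>, of s p] s p sub by (auto simp: E_def)
      hence "t \<in> coord.span {p, s}"
        using coord.in_span_insert[of p t "{s}"] p by (simp add: insert_commute)
      thus ?thesis using coord.span_mono[of "{p, s}" "insert s E'"] p by blast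
    qed (use coord.span_base in blast)
    hence "coord.dim (insert s E' \<union> E) = coord.dim (insert s E')"
      using fin by (intro coord_rank.rank_Un_spans) (auto simp: coord_spans_iff)
    moreover have "insert s E' \<union> E = E" using s sub by auto
    ultimately have "coord.dim E = coord.dim (insert s E')" by simp
    thus ?thesis using out[OF s order_refl] fin by (simp add: coord_dim_insert)
  qed
qed

lemma has_chain_refl: "has_chain l \<Gamma> \<Gamma>"
proof -
  have "a \<notin> coord.span {}" if "a \<in> gain_vectors l \<Gamma>" for a
    using gain_vectors_nonloop[OF that] coord_dim_insert[of "{}" a] coord_rank.rank_empty
    by (auto split: if_splits)
  hence "coord_rank.closed_in (gain_vectors l \<Gamma>) {}"
    by (simp add: coord_rank.closed_in_def coord_spans_iff)
  hence "coord_rank.divisional_chain (gain_vectors l \<Gamma>) (gain_vectors l \<Gamma>) (\<lambda>_. {}) 0"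
    by (simp add: coord_rank.divisional_chain_def coord_rank.rank_empty)
  thus ?thesis unfolding has_chain_def by blast
qed

text \<open>The coatom step is followed by the chain of the graph without \<open>v\<close>. The edge
  \<open>e\<close> at \<open>v\<close> that starts the chain can be prescribed, which the exchange
  argument below exploits.\<close>

lemma divisional_chain_link_simplicial:
  fixes \<Gamma> :: "('v, 'k::field) gain_graph"
  assumes l: "embeds l (verts \<Gamma>)" and \<Gamma>: "loopless_gain_graph \<Gamma>" and v: "link_simplicial \<Gamma> v"
    and W: "W \<subseteq> verts \<Gamma> - {v}"
    and chain: "has_chain l (induced \<Gamma> (verts \<Gamma> - {v})) (induced \<Gamma> W)"
    and e: "e \<in> gain_vectors l \<Gamma> - gain_vectors l (induced \<Gamma> (verts \<Gamma> - {v}))"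
  shows "\<exists>F k. coord_rank.divisional_chain (gain_vectors l \<Gamma>) (gain_vectors l (induced \<Gamma> W)) F (Suc k) \<and>
    F 1 = {e}"
proof -
  let ?E' = "gain_vectors l (induced \<Gamma> (verts \<Gamma> - {v}))"
  obtain G k where G: "coord_rank.divisional_chain ?E' (gain_vectors l (induced \<Gamma> W)) G k"
    using chain by (auto simp: has_chain_def)
  have sub: "gain_vectors l (induced \<Gamma> W) \<subseteq> ?E'"
    using gain_vectors_induced_subset[of l "induced \<Gamma> (verts \<Gamma> - {v})" W] W by (simp add: induced_induced)
  note mod = modular_over_link_simplicial[OF l \<Gamma> v]
  have "coord_rank.divisional_chain (gain_vectors l \<Gamma>) ?E' (\<lambda>i. if i = 0 then {} else {e}) 1"
    using gain_vectors_simple[OF l \<Gamma>] e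
    by (intro coord_rank.divisional_chain_coatom finite_gain_vectors \<Gamma> gain_vectors_induced_subset mod
        gain_vectors_nonloop) (auto simp: coord_spans_iff)
  from coord_rank.divisional_chain_trans[OF finite_gain_vectors[OF \<Gamma>] gain_vectors_induced_subset sub mod(1) this G]
  obtain F where "coord_rank.divisional_chain (gain_vectors l \<Gamma>) (gain_vectors l (induced \<Gamma> W)) F (Suc k)"
    "F 1 = {e}" unfolding plus_1_eq_Suc by simp
  thus ?thesis by blast
qed

lemma full_gain_vec_in_span:
  fixes \<Gamma> :: "('v, 'k::field) gain_graph"
  assumes l: "embeds l (verts \<Gamma>)" and full: "gain_full \<Gamma> W" and "a \<in> W" "b \<in> W" "a \<noteq> b" "h \<in> gains \<Gamma>"
  shows "gain_vec (l a) (l b) h \<in> coord.span (gain_vectors l (induced \<Gamma> W))"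
proof -
  have "gain_edge a b h \<in> edges (induced \<Gamma> W)"
    using assms by (auto simp: gain_full_def gain_edge_induced_iff)
  moreover have "l a \<noteq> l b" using assms by (auto simp: gain_full_def embeds_def inj_on_def)
  ultimately show ?thesis
    using gain_vec_mem_gain_vectors[of a b h "induced \<Gamma> W" l] coord.span_base span_minus_iff by blast
qed

text \<open>The edge from \<open>a\<close> to \<open>u\<close> with gain \<open>h\<close> is the sum
  of the edge from \<open>a\<close> to \<open>v\<close> with gain \<open>h - g\<close>, present by
  fullness, and the given one from \<open>v\<close> to \<open>u\<close> with gain
  \<open>g\<close>.\<close>

lemma full_swap_span:
  fixes \<Gamma> :: "('v, 'k::field) gain_graph"
  assumes l: "embeds l (verts \<Gamma>)" and \<Gamma>: "loopless_gain_graph \<Gamma>" and full: "gain_full \<Gamma> (insert v R)"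
    and uv: "u \<noteq> v" "u \<notin> R" "v \<notin> R" and g: "g \<in> gains \<Gamma>" "gain_vec (l v) (l u) g \<in> coord.span M"
    and M: "gain_vectors l (induced \<Gamma> (insert v R)) \<subseteq> M" and x: "x \<in> gain_vectors l (induced \<Gamma> (insert u R))"
  shows "x \<in> coord.span M"
proof -
  have G: "additive_subgroup (gains \<Gamma>)" using \<Gamma> by (simp add: loopless_gain_graph_def)
  have fv: "gain_vec (l a) (l b) h \<in> coord.span M"
    if "a \<in> insert v R" "b \<in> insert v R" "a \<noteq> b" "h \<in> gains \<Gamma>" for a b h
    using full_gain_vec_in_span[OF l full that] coord.span_mono[OF M] by blast
  have star: "gain_vec (l a) (l u) h \<in> coord.span M" if "a \<in> R" "h \<in> gains \<Gamma>" for a h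
  proof -
    have "h + - g \<in> gains \<Gamma>" using G that g unfolding additive_subgroup_def by blast
    hence "gain_vec (l a) (l v) (h + - g) \<in> coord.span M" using that uv by (intro fv) auto
    from coord.span_add[OF this g(2)] show ?thesis by (simp add: gain_vec_add)
  qed
  show ?thesis using x
  proof (cases rule: gain_vectors_cases)
    case 1
    thus ?thesis using M coord.span_base by (auto simp: gain_vectors_def)
  next
    case (2 a b h)
    have e: "gain_edge a b h \<in> edges \<Gamma>" "a \<in> insert u R" "b \<in> insert u R"
      using 2 by (auto simp: gain_edge_induced_iff)
    note ab = loopless_gain_edgeD[OF \<Gamma> e(1)]
    consider "a \<in> R" "b \<in> R" | "a \<in> R" "b = u" | "a = u" "b \<in> R" using e ab by blast
    thus ?thesis
    proof cases
      case 1
      thus ?thesis using fv[of a b h] ab 2 by simp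
    next
      case 3
      have "- h \<in> gains \<Gamma>" using G ab by (simp add: additive_subgroup_def)
      hence "- gain_vec (l u) (l b) h \<in> coord.span M"
        using star[of b "- h"] 3 by (simp add: gain_vec_swap)
      thus ?thesis using 2 3 span_minus_iff by blast
    qed (use star ab 2 in auto)
  qed
qed

text \<open>The induction hypothesis covers only sets without \<open>v\<close>, so it is applied to
  \<open>insert u R\<close>, which is full because \<open>v\<close> is link-simplicial. The
  resulting chain starts with the edge from \<open>v\<close> to \<open>u\<close>, modulo which
  \<open>W\<close> and \<open>insert u R\<close> span the same.\<close>

lemma has_chain_link_simplicial_exchange:
  fixes \<Gamma> :: "('v, 'k::field) gain_graph"
  assumes l: "embeds l (verts \<Gamma>)" and \<Gamma>: "loopless_gain_graph \<Gamma>" and v: "link_simplicial \<Gamma> v"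
    and full: "gain_full \<Gamma> W" and W: "v \<in> W" "u \<notin> W" and edge: "gain_edge v u g \<in> edges \<Gamma>"
    and IH: "\<And>W. gain_full (induced \<Gamma> (verts \<Gamma> - {v})) W \<Longrightarrow>
      has_chain l (induced \<Gamma> (verts \<Gamma> - {v})) (induced \<Gamma> W)"
  shows "has_chain l \<Gamma> (induced \<Gamma> W)"
proof -
  define R where "R = W - {v}"
  have WR: "W = insert v R" "v \<notin> R" "u \<notin> R" using W by (auto simp: R_def)
  note uv = loopless_gain_edgeD[OF \<Gamma> edge]
  have G: "additive_subgroup (gains \<Gamma>)" using \<Gamma> by (simp add: loopless_gain_graph_def)
  have uR: "gain_edge u w h \<in> edges \<Gamma>" if "w \<in> R" "h \<in> gains \<Gamma>" for w h
  proof -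
    \<comment> \<open>The gain \<open>g + h\<close> of the edge from \<open>v\<close> to
      \<open>w\<close> is chosen so that the path from \<open>u\<close> through \<open>v\<close> to
      \<open>w\<close> has gain \<open>h\<close>.\<close>
    have "g + h \<in> gains \<Gamma>" using G uv that by (simp add: additive_subgroup_def)
    moreover have "v \<noteq> w" "v \<in> W" "w \<in> W" using that WR by auto
    ultimately have "gain_edge v w (g + h) \<in> edges \<Gamma>" using full by (simp add: gain_full_def)
    moreover have "gain_edge u v (- g) \<in> edges \<Gamma>" using edge by (simp add: gain_edge_swap)
    moreover have "u \<noteq> w" using that WR by auto
    ultimately have "gain_edge u w (- g + (g + h)) \<in> edges \<Gamma>" using v unfolding link_simplicial_def by blast
    thus ?thesis by simp
  qed
  have Ru: "gain_edge w u h \<in> edges \<Gamma>" if "w \<in> R" "h \<in> gains \<Gamma>" for w h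
    using uR[of w "- h"] that G gain_edge_swap[of u w h] by (simp add: additive_subgroup_def)
  have RV: "insert u R \<subseteq> verts \<Gamma> - {v}" using full WR uv by (auto simp: gain_full_def)
  have full': "gain_full \<Gamma> (insert u R)"
    using full WR uR Ru uv by (auto simp: gain_full_def)
  hence "gain_full (induced \<Gamma> (verts \<Gamma> - {v})) (insert u R)"
    using gain_full_induced_iff[OF RV Diff_subset] by simp
  hence chain: "has_chain l (induced \<Gamma> (verts \<Gamma> - {v})) (induced \<Gamma> (insert u R))" by (rule IH)
  have "l v \<noteq> l u" using l uv by (auto simp: embeds_def inj_on_def)
  then obtain e where e: "e \<in> gain_vectors l \<Gamma>" "e = gain_vec (l v) (l u) g \<or> e = - gain_vec (l v) (l u) g"
    using gain_vec_mem_gain_vectors[OF edge] by blast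
  have esp: "gain_vec (l v) (l u) g \<in> coord.span (insert e M)"
    "gain_vec (l u) (l v) (- g) \<in> coord.span (insert e M)" for M
    using coord.span_base[of e "insert e M"] e(2) span_minus_iff by (auto simp: gain_vec_swap)
  have "e \<notin> coord.span (gain_vectors l (induced \<Gamma> (verts \<Gamma> - {v})))"
    using star_vector_not_in_span[OF l \<Gamma> order_refl uv(1) e(2) uv(2)] uv(3) by blast
  hence "e \<notin> gain_vectors l (induced \<Gamma> (verts \<Gamma> - {v}))" using coord.span_base by blast
  with divisional_chain_link_simplicial[OF l \<Gamma> v RV chain] e obtain F k where
    F: "coord_rank.divisional_chain (gain_vectors l \<Gamma>) (gain_vectors l (induced \<Gamma> (insert u R))) F (Suc k)"
      "F 1 = {e}" by blast
  let ?X = "gain_vectors l (induced \<Gamma> W)" and ?X' = "gain_vectors l (induced \<Gamma> (insert u R))"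
  have "coord_rank.divisional_chain (gain_vectors l \<Gamma>) ?X F (Suc k)"
  proof (rule coord_rank.divisional_chain_exchange[OF finite_gain_vectors[OF \<Gamma>]
        gain_vectors_induced_subset gain_vectors_induced_subset gain_vectors_nonloop _ F])
    have finX: "finite ?X" "finite ?X'"
      using finite_gain_vectors[OF \<Gamma>] gain_vectors_induced_subset finite_subset by metis+
    \<comment> \<open>Modularity of a full set in the whole graph is the gluing lemma whose first
      part consists of all vertices.\<close>
    have "insert u R \<subseteq> verts \<Gamma>" using RV by auto
    moreover have "gain_vectors l (induced \<Gamma> (verts \<Gamma>)) = gain_vectors l \<Gamma>"
      using loopless_gain_edgeD[OF \<Gamma>] by (auto simp: gain_vectors_def gain_edge_induced_iff)
    ultimately show "coord_rank.modular_over (gain_vectors l \<Gamma> - ?X') ?X' ?X'"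
      using modular_over_glue[OF l \<Gamma> order_refl, of "insert u R"] full' by (simp add: Int_absorb1)
    have "- g \<in> gains \<Gamma>" using G uv by (simp add: additive_subgroup_def)
    thus "coord_rank.spans (insert e ?X') x" if "x \<in> ?X" for x
      using full_swap_span[OF l \<Gamma> full' uv(3) WR(2,3) _ esp(2) subset_insertI] that WR(1) finX
      by (simp add: coord_spans_iff)
    show "coord_rank.spans (insert e ?X) x" if "x \<in> ?X'" for x
      using full_swap_span[OF l \<Gamma> _ uv(3)[symmetric] WR(3,2) uv(4) esp(1) subset_insertI that] full WR(1) finX
      by (simp add: coord_spans_iff)
    have "W \<subseteq> verts \<Gamma> - {u}" using full W by (auto simp: gain_full_def)
    moreover have "e = gain_vec (l u) (l v) (- g) \<or> e = - gain_vec (l u) (l v) (- g)"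
      using e(2) by (auto simp: gain_vec_swap)
    ultimately show "\<not> coord_rank.spans ?X e"
      using star_vector_not_in_span[OF l \<Gamma> _ uv(2) _ uv(1) uv(3), of W e "- g" ?X] finX
      by (simp add: coord_spans_iff)
  qed
  thus ?thesis unfolding has_chain_def by blast
qed

section \<open>Induction over the class\<close>

lemma gain_class_loopless:
  assumes "gain_class G \<Gamma>" "additive_subgroup G"
  shows "loopless_gain_graph \<Gamma> \<and> gains \<Gamma> = G"
  using assms by cases (auto simp: loopless_gain_graph_def null_gain_graph_def)

lemma gain_class_has_chain:
  fixes \<Gamma> :: "('v, 'k::field) gain_graph"
  assumes "gain_class G \<Gamma>" "additive_subgroup G" "embeds l (verts \<Gamma>)" "gain_full \<Gamma> W"
  shows "has_chain l \<Gamma> (induced \<Gamma> W)"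
  using assms(1,3,4)
proof (induction arbitrary: W)
  case null
  have "gain_vectors l (induced (null_gain_graph G) W) = gain_vectors l (null_gain_graph G)"
    by (simp add: gain_vectors_def null_gain_graph_def induced_def)
  thus ?case using has_chain_refl[of l "null_gain_graph G"] by (simp add: has_chain_def)
next
  case (simplicial \<Gamma> v)
  note l = simplicial.prems(1) and \<Gamma> = simplicial.hyps(1) and v = simplicial.hyps(3)
  let ?V = "verts \<Gamma> - {v}"
  have IH: "has_chain l (induced \<Gamma> ?V) (induced \<Gamma> W)" if "gain_full (induced \<Gamma> ?V) W" for W
  proof -
    have "W \<subseteq> ?V" using that by (simp add: gain_full_def induced_def)
    thus ?thesis using simplicial.IH[of W] that embeds_subset[OF l, of ?V]
      by (simp add: delete_vertex_def induced_induced) (simp add: induced_def)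
  qed
  show ?case
  proof (cases "v \<in> W")
    case False
    hence W: "W \<subseteq> ?V" using simplicial.prems by (auto simp: gain_full_def)
    hence chain: "has_chain l (induced \<Gamma> ?V) (induced \<Gamma> W)"
      using simplicial.prems by (intro IH) (simp add: gain_full_induced_iff)
    show ?thesis
    proof (cases "gain_vectors l \<Gamma> \<subseteq> gain_vectors l (induced \<Gamma> ?V)")
      \<comment> \<open>Deleting \<open>v\<close> loses no vector, and \<open>has_chain\<close> sees
        nothing else.\<close>
      case True
      hence "gain_vectors l \<Gamma> = gain_vectors l (induced \<Gamma> ?V)" using gain_vectors_induced_subset by blast
      thus ?thesis using chain by (simp add: has_chain_def)
    next
      case False
      then obtain e where "e \<in> gain_vectors l \<Gamma> - gain_vectors l (induced \<Gamma> ?V)" by blast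
      from divisional_chain_link_simplicial[OF l \<Gamma> v W chain this] show ?thesis
        unfolding has_chain_def by blast
    qed
  next
    case vW: True
    show ?thesis
    proof (cases "\<exists>u g. gain_edge v u g \<in> edges \<Gamma> \<and> u \<notin> W")
      case True
      thus ?thesis
        using has_chain_link_simplicial_exchange[OF l \<Gamma> v simplicial.prems(2) vW _ _ IH] by blast
    next
      case False
      have WV: "W \<subseteq> verts \<Gamma>" using simplicial.prems by (simp add: gain_full_def)
      \<comment> \<open>All neighbours of \<open>v\<close> lie in \<open>W\<close>, so the graph is
        glued from the graph without \<open>v\<close> and the induced graph on \<open>W\<close>. The
        chain of the former can be kept.\<close>
      have full: "gain_full \<Gamma> (?V \<inter> W)" using simplicial.prems by (auto simp: gain_full_def)
      show ?thesis
      proof (rule has_chain_glue[OF l \<Gamma> _ WV full])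
        show "has_chain l (induced \<Gamma> ?V) (induced \<Gamma> (?V \<inter> W))"
          using full by (intro IH) (auto simp: gain_full_induced_iff)
      next
        fix a b h assume e: "gain_edge a b h \<in> edges \<Gamma>"
        hence "gain_edge b a (- h) \<in> edges \<Gamma>" by (simp add: gain_edge_swap)
        thus "a \<in> ?V \<and> b \<in> ?V \<or> a \<in> W \<and> b \<in> W"
          using e False vW loopless_gain_edgeD[OF \<Gamma> e] by blast
      qed simp
    qed
  qed
next
  case (glue \<Gamma> V1 V2)
  note l = glue.prems(1) and \<Gamma> = glue.hyps(1)
  have G: "gains \<Gamma> = G" "verts \<Gamma> = V1 \<union> V2" using glue.hyps by auto
  have full: "gain_full \<Gamma> (V1 \<inter> V2)"
  proof -
    have "gain_edge u v g \<in> edges (induced \<Gamma> (V1 \<inter> V2))"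
      if "u \<in> V1 \<inter> V2" "v \<in> V1 \<inter> V2" "u \<noteq> v" "g \<in> G" for u v g
      using that glue.hyps assms(2) by (simp add: gain_edge_complete_iff)
    thus ?thesis using G by (auto simp: gain_full_def gain_edge_induced_iff)
  qed
  have cover: "u \<in> V1 \<and> v \<in> V1 \<or> u \<in> V2 \<and> v \<in> V2" if "gain_edge u v g \<in> edges \<Gamma>" for u v g
    using that glue.hyps by (metis Un_iff gain_edge_induced_iff)
  have IH1: "has_chain l (induced \<Gamma> V1) (induced \<Gamma> U)" if "U \<subseteq> V1" "gain_full \<Gamma> U" for U
  proof -
    have "embeds l (verts (induced \<Gamma> V1))" using embeds_subset[OF l, of V1] G by (simp add: induced_def)
    thus ?thesis using glue.IH(1)[of U] that G by (simp add: gain_full_induced_iff induced_induced)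
  qed
  have IH2: "has_chain l (induced \<Gamma> V2) (induced \<Gamma> U)" if "U \<subseteq> V2" "gain_full \<Gamma> U" for U
  proof -
    have "embeds l (verts (induced \<Gamma> V2))" using embeds_subset[OF l, of V2] G by (simp add: induced_def)
    thus ?thesis using glue.IH(2)[of U] that G by (simp add: gain_full_induced_iff induced_induced)
  qed
  \<comment> \<open>Distinct vertices of a full set are joined by an edge of gain 0, and no edge
    connects the two differences \<open>V1 - V2\<close> and \<open>V2 - V1\<close>.\<close>
  have "W \<subseteq> V1 \<or> W \<subseteq> V2"
  proof (rule ccontr)
    assume "\<not> ?thesis"
    then obtain a b where ab: "a \<in> W" "a \<notin> V1" "b \<in> W" "b \<notin> V2" by blast
    hence "a \<noteq> b" using glue.prems(2) G by (auto simp: gain_full_def)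
    hence "gain_edge a b 0 \<in> edges \<Gamma>"
      using ab glue.prems(2) G assms(2) by (auto simp: gain_full_def additive_subgroup_def)
    thus False using cover ab by blast
  qed
  thus ?case
  proof
    assume W: "W \<subseteq> V1"
    \<comment> \<open>The part that is not known to contain \<open>W\<close> comes first, so that
      the chain can end inside the other one.\<close>
    show ?thesis
    proof (rule has_chain_glue_trans[OF l \<Gamma>, of V2 V1])
      show "has_chain l (induced \<Gamma> V2) (induced \<Gamma> (V2 \<inter> V1))"
        using IH2[of "V2 \<inter> V1"] full by (simp add: Int_commute)
    qed (use G full cover W IH1 glue.prems in \<open>auto simp: Int_commute\<close>)
  next
    assume W: "W \<subseteq> V2"
    show ?thesis
    proof (rule has_chain_glue_trans[OF l \<Gamma>, of V1 V2])
      show "has_chain l (induced \<Gamma> V1) (induced \<Gamma> (V1 \<inter> V2))"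
        using IH1[of "V1 \<inter> V2"] full by simp
    qed (use G full cover W IH2 glue.prems in auto)
  qed
qed

section \<open>Hyperplanes and their normal vectors\<close>

definition hyperplane_of :: "nat \<Rightarrow> (nat \<Rightarrow> 'k::field) \<Rightarrow> (nat \<Rightarrow> 'k) set" where
  "hyperplane_of n f = {x \<in> coord_space n. (\<Sum>i<n. f i * x i) = 0}"

lemma sum_unit_vec_expand:
  "(\<Sum>i<n. vscale (f i) (unit_vec i)) = (\<lambda>k. if k < n then f k else 0)"
  by (induction n) (auto simp: fun_eq_iff vscale_def unit_vec_def less_Suc_eq)

lemma coord_space_expand: "f \<in> coord_space n \<Longrightarrow> f = (\<Sum>i<n. vscale (f i) (unit_vec i))"
  by (auto simp: sum_unit_vec_expand coord_space_def fun_eq_iff)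

lemma coord_space_subset_span: "coord_space n \<subseteq> coord.span (unit_vec ` {..<n})"
proof
  fix f :: "nat \<Rightarrow> 'a" assume "f \<in> coord_space n"
  hence f: "f = (\<Sum>i<n. vscale (f i) (unit_vec i))" by (rule coord_space_expand)
  have "(\<Sum>i<n. vscale (f i) (unit_vec i)) \<in> coord.span (unit_vec ` {..<n})"
    by (rule coord.span_sum) (simp add: coord.span_scale coord.span_base)
  thus "f \<in> coord.span (unit_vec ` {..<n})" using f by simp
qed

lemma dim_coord_space: "coord.dim (coord_space n :: (nat \<Rightarrow> 'k::field) set) = n"
proof -
  let ?U = "\<lambda>k. unit_vec ` {..<k} :: (nat \<Rightarrow> 'k) set"
  have "coord.dim (?U k) = k" for k
  proof (induction k)
    case (Suc k)
    have "(unit_vec k :: nat \<Rightarrow> 'k) \<notin> coord.span (?U k)"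
    proof
      assume "unit_vec k \<in> coord.span (?U k)"
      hence "unit_vec k k = (0 :: 'k)" by (rule span_vanish) (auto simp: unit_vec_def)
      thus False by (simp add: unit_vec_def)
    qed
    thus ?case using Suc by (simp add: lessThan_Suc coord_dim_insert)
  qed (simp add: coord_rank.rank_empty)
  moreover have "?U n \<subseteq> coord_space n" by (auto simp: coord_space_def unit_vec_def)
  hence "coord.span (?U n) \<subseteq> coord.span (coord_space n)" by (rule coord.span_mono)
  hence "coord.span (coord_space n :: (nat \<Rightarrow> 'k) set) = coord.span (?U n)"
    using coord.span_minimal[OF coord_space_subset_span coord.subspace_span] by (intro equalityI)
  hence "coord.dim (coord_space n :: (nat \<Rightarrow> 'k) set) = coord.dim (?U n)" by (rule coord.span_eq_dim)
  ultimately show ?thesis by simp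
qed

text \<open>\<open>U\<close> may be infinite, so \<open>coord_dim_insert\<close> is applied to a
  basis of \<open>U\<close>; this is finite as an independent set in the span of \<open>n\<close>
  unit vectors.\<close>

lemma dim_insert_subspace:
  fixes U :: "(nat \<Rightarrow> 'k::field) set"
  assumes U: "coord.subspace U" "U \<subseteq> coord_space n" and x: "x \<notin> U"
  shows "coord.dim (insert x U) = Suc (coord.dim U)"
proof -
  obtain B where B: "B \<subseteq> U" "coord.independent B" "U \<subseteq> coord.span B" "card B = coord.dim U"
    using coord.basis_exists by blast
  have "B \<subseteq> coord.span (unit_vec ` {..<n})" using B U coord_space_subset_span by blast
  hence finB: "finite B" using coord.independent_span_bound[of "unit_vec ` {..<n}" B] B by simp
  have sp: "coord.span B = U" using B(1,3) coord.span_minimal[OF B(1) U(1)] by auto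
  have "coord.span U = U" using U(1) by (simp add: coord.span_eq_iff)
  hence "coord.span (insert x B) = coord.span (insert x U)" by (simp only: coord.span_insert sp)
  hence "coord.dim (insert x U) = coord.dim (insert x B)" using coord.span_eq_dim by metis
  also have "\<dots> = Suc (coord.dim B)" using x sp finB by (simp add: coord_dim_insert)
  also have "coord.dim B = coord.dim U" using B coord.dim_eq_card_independent by metis
  finally show ?thesis .
qed

text \<open>A basis \<open>B\<close> of the span of \<open>S\<close> stays independent when
  \<open>f\<close> is added, so some linear functional is 1 at \<open>f\<close> and 0 on
  \<open>S\<close>. Its values at the unit vectors are the coordinates of \<open>x\<close>.\<close>

lemma separating_point:
  fixes S :: "(nat \<Rightarrow> 'k::field) set"
  assumes f: "f \<notin> coord.span S" and n: "f \<in> coord_space n" "S \<subseteq> coord_space n"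
  shows "\<exists>x\<in>coord_space n. (\<Sum>i<n. f i * x i) = 1 \<and> (\<forall>s\<in>S. (\<Sum>i<n. s i * x i) = 0)"
proof -
  have vsp: "vector_space_pair (vscale :: 'k \<Rightarrow> _) ((*) :: 'k \<Rightarrow> 'k \<Rightarrow> 'k)"
    by (intro vector_space_pair.intro coord.vector_space_axioms vector_space.intro)
      (simp_all add: algebra_simps)
  obtain B where B: "B \<subseteq> S" "coord.independent B" "S \<subseteq> coord.span B"
    by (rule coord.basis_exists)
  have "f \<notin> coord.span B" using f coord.span_mono[OF B(1)] by blast
  hence "coord.independent (insert f B)" using B by (simp add: coord.independent_insertI)
  from vector_space_pair.linear_independent_extend[OF vsp this, of "\<lambda>x. if x = f then 1 else 0"]
  obtain \<phi> where lin: "Vector_Spaces.linear vscale (*) \<phi>"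
    and \<phi>: "\<forall>x\<in>insert f B. \<phi> x = (if x = f then 1 else 0)" by blast
  have add: "\<phi> (x + y) = \<phi> x + \<phi> y" and scale: "\<phi> (vscale c x) = c * \<phi> x" for c x y
    using lin by (simp_all add: Vector_Spaces.linear_iff_module_hom module_hom_iff)
  have zero: "\<phi> 0 = 0" using scale[of 0 0] by (simp add: vscale_def zero_fun_def)
  have sum: "\<phi> (\<Sum>i<k. v i) = (\<Sum>i<k. \<phi> (v i))" for k :: nat and v
    by (induction k) (simp_all only: sum.lessThan_Suc lessThan_0 sum.empty zero add)
  have "f \<notin> B" using \<open>f \<notin> coord.span B\<close> coord.span_base by blast
  have vanish: "\<phi> s = 0" if "s \<in> coord.span B" for s
    using that
  proof (induction rule: coord.span_induct_alt)
    case (step c b y)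
    hence "\<phi> b = 0" using \<phi> \<open>f \<notin> B\<close> by auto
    thus ?case using step by (simp only: add scale) simp
  qed (rule zero)
  define x where "x = (\<lambda>i. if i < n then \<phi> (unit_vec i) else 0)"
  have eval: "(\<Sum>i<n. h i * x i) = \<phi> h" if "h \<in> coord_space n" for h
  proof -
    have "\<phi> h = \<phi> (\<Sum>i<n. vscale (h i) (unit_vec i))" using coord_space_expand[OF that] by simp
    thus ?thesis by (simp add: sum scale x_def)
  qed
  have "x \<in> coord_space n" by (simp add: x_def coord_space_def)
  moreover have "(\<Sum>i<n. f i * x i) = 1" using eval[OF n(1)] \<phi> by simp
  moreover have "(\<Sum>i<n. s i * x i) = 0" if "s \<in> S" for s
  proof -
    have "s \<in> coord_space n" "s \<in> coord.span B" using subsetD[OF n(2) that] subsetD[OF B(3) that] .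
    thus ?thesis using eval vanish by simp
  qed
  ultimately show ?thesis by blast
qed

text \<open>A redundant equation changes no solution. Any other lowers the dimension by exactly one,
  since a separating point together with the new solutions spans the old ones.\<close>

lemma dim_solutions:
  fixes S :: "(nat \<Rightarrow> 'k::field) set"
  assumes "finite S" "S \<subseteq> coord_space n"
  shows "coord.dim (coord_space n \<inter> \<Inter>(hyperplane_of n ` S)) + coord.dim S = n"
  using assms
proof (induction S)
  case empty
  thus ?case by (simp add: dim_coord_space coord_rank.rank_empty)
next
  case (insert f S)
  let ?sol = "\<lambda>S. coord_space n \<inter> \<Inter>(hyperplane_of n ` S)"
  have sol: "x \<in> ?sol S \<longleftrightarrow> x \<in> coord_space n \<and> (\<forall>s\<in>S. (\<Sum>i<n. s i * x i) = 0)" for x S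
    by (auto simp: hyperplane_of_def)
  have sub: "coord.subspace (?sol S)" for S
    by (rule coord.subspaceI; unfold sol)
      (auto simp: coord_space_def vscale_def distrib_left sum.distrib mult.left_commute
        sum_distrib_left[symmetric])
  show ?case
  proof (cases "f \<in> coord.span S")
    case True
    have "(\<Sum>i<n. f i * x i) = 0" if x: "\<forall>s\<in>S. (\<Sum>i<n. s i * x i) = 0" for x
      using True
      by (induction rule: coord.span_induct_alt)
        (use x in \<open>simp_all add: vscale_def distrib_right sum.distrib mult.assoc sum_distrib_left[symmetric]\<close>)
    hence "?sol (insert f S) = ?sol S" unfolding set_eq_iff sol by blast
    thus ?thesis using insert True by (simp add: coord_dim_insert)
  next
    case False
    then obtain x where x: "x \<in> coord_space n" "(\<Sum>i<n. f i * x i) = 1" "\<forall>s\<in>S. (\<Sum>i<n. s i * x i) = 0"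
      using separating_point[of f S n] insert.prems by auto
    have "x \<notin> ?sol (insert f S)" unfolding sol using x by auto
    hence "coord.dim (insert x (?sol (insert f S))) = Suc (coord.dim (?sol (insert f S)))"
      by (intro dim_insert_subspace[OF sub]) auto
    moreover have "coord.span (insert x (?sol (insert f S))) = coord.span (?sol S)"
    proof
      have "insert x (?sol (insert f S)) \<subseteq> ?sol S" using x sol[of x S] by auto
      thus "coord.span (insert x (?sol (insert f S))) \<subseteq> coord.span (?sol S)" by (rule coord.span_mono)
    next
      have "y \<in> coord.span (insert x (?sol (insert f S)))" if y: "y \<in> ?sol S" for y
      proof -
        \<comment> \<open>As \<open>f\<close> takes the value 1 at \<open>x\<close>, subtracting
          \<open>c\<close> times \<open>x\<close> from \<open>y\<close> makes \<open>f\<close>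
          vanish.\<close>
        define c where "c = (\<Sum>i<n. f i * y i)"
        have "(\<Sum>i<n. s i * (y - vscale c x) i) = (\<Sum>i<n. s i * y i) - c * (\<Sum>i<n. s i * x i)" for s
          by (simp add: vscale_def right_diff_distrib sum_subtractf sum_distrib_left mult.left_commute)
        moreover have "y - vscale c x \<in> coord_space n"
          using x(1) y by (simp add: coord_space_def vscale_def)
        ultimately have "y - vscale c x \<in> ?sol (insert f S)"
          using x y unfolding sol by (auto simp: c_def)
        hence "y - vscale c x \<in> coord.span (?sol (insert f S))" by (rule coord.span_base)
        thus ?thesis unfolding coord.span_breakdown_eq by (rule exI)
      qed
      thus "coord.span (?sol S) \<subseteq> coord.span (insert x (?sol (insert f S)))"
        by (intro coord.span_minimal coord.subspace_span subsetI)
    qed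
    ultimately have "coord.dim (?sol S) = Suc (coord.dim (?sol (insert f S)))"
      using coord.span_eq_dim by metis
    thus ?thesis using insert False by (simp add: coord_dim_insert)
  qed
qed

lemma codim_hyperplanes:
  fixes S :: "(nat \<Rightarrow> 'k::field) set"
  assumes "finite S" "S \<subseteq> coord_space n"
  shows "codim n (coord_space n \<inter> \<Inter>(hyperplane_of n ` S)) = coord.dim S"
  using dim_solutions[OF assms] by (simp add: codim_def dim_coord_space)

lemma hyperplane_of_unit_vec: "0 < n \<Longrightarrow> hyperplane_of n (unit_vec 0) = {x \<in> coord_space n. x 0 = 0}"
  by (simp add: hyperplane_of_def unit_vec_def if_distrib[of "\<lambda>a. a * _"] cong: if_cong)

lemma hyperplane_of_gain_vec:
  assumes "i < n" "j < n"
  shows "hyperplane_of n (gain_vec i j g) = {x \<in> coord_space n. x i - x j = g * x 0}"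
proof -
  have unit: "(\<Sum>k<n. unit_vec a k * x k) = x a" if "a < n" for a and x :: "nat \<Rightarrow> 'a"
    using that by (simp add: unit_vec_def if_distrib[of "\<lambda>a. a * _"] cong: if_cong)
  have "(\<Sum>k<n. gain_vec i j g k * x k) = x i - x j - g * x 0" for x
    using assms unit[of i x] unit[of j x] unit[of 0 x]
    by (simp add: gain_vec_def left_diff_distrib sum_subtractf mult.assoc sum_distrib_left[symmetric])
  thus ?thesis by (simp add: hyperplane_of_def)
qed

theorem theorem4p22:
  fixes G :: "'k::field set" and \<Gamma> :: "('v, 'k) gain_graph" and l :: "'v \<Rightarrow> nat"
  assumes "finite G" and "additive_subgroup G"
    and "gain_class G \<Gamma>"
    and "labeling \<Gamma> l"
  shows "divisionally_free (ambient_dim \<Gamma>) (gain_arrangement l \<Gamma>)"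
proof -
  define n where "n = ambient_dim \<Gamma>"
  define E where "E = gain_vectors l \<Gamma>"
  define b where "b = (hyperplane_of n :: (nat \<Rightarrow> 'k) \<Rightarrow> _)"
  have \<Gamma>: "loopless_gain_graph \<Gamma>" using gain_class_loopless[OF assms(3,2)] by blast
  have img: "l ` verts \<Gamma> = {1..card (verts \<Gamma>)}" and inj: "inj_on l (verts \<Gamma>)"
    using assms(4) by (auto simp: labeling_def bij_betw_def)
  have l: "embeds l (verts \<Gamma>)" using img inj by (auto simp: embeds_def)
  have ln: "l u < n" if "u \<in> verts \<Gamma>" for u
  proof -
    have "l u \<in> {1..card (verts \<Gamma>)}" using that img by blast
    thus ?thesis by (simp add: n_def ambient_dim_def)
  qed
  have n0: "0 < n" by (simp add: n_def ambient_dim_def)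
  have finE: "finite E" using finite_gain_vectors[OF \<Gamma>] by (simp add: E_def)
  have En: "E \<subseteq> coord_space n"
    using gain_vectors_support[OF \<Gamma>] img
    by (auto simp: E_def coord_space_def n_def ambient_dim_def)
  have b_gain: "b (gain_vec (l u) (l v) g) = {x \<in> coord_space n. x (l u) - x (l v) = g * x 0}"
    if "gain_edge u v g \<in> edges \<Gamma>" for u v g
    using loopless_gain_edgeD[OF \<Gamma> that] ln by (simp add: b_def hyperplane_of_gain_vec)
  have A: "gain_arrangement l \<Gamma> = b ` E"
  proof
    show "b ` E \<subseteq> gain_arrangement l \<Gamma>"
    proof (rule image_subsetI)
      fix x assume "x \<in> E"
      hence "x \<in> gain_vectors l \<Gamma>" by (simp add: E_def)
      thus "b x \<in> gain_arrangement l \<Gamma>"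
      proof (cases rule: gain_vectors_cases)
        case 1
        thus ?thesis using n0 by (simp add: gain_arrangement_def b_def hyperplane_of_unit_vec n_def)
      next
        case (2 u v g)
        thus ?thesis using b_gain[OF 2(2)] by (auto simp: gain_arrangement_def n_def)
      qed
    qed
    have "{x \<in> coord_space n. x (l u) - x (l v) = g * x 0} \<in> b ` E" if e: "gain_edge u v g \<in> edges \<Gamma>" for u v g
    proof (cases "l u < l v")
      case True
      hence "gain_vec (l u) (l v) g \<in> E" using e by (auto simp: E_def gain_vectors_def)
      thus ?thesis using b_gain[OF e] by blast
    next
      case False
      have "l u \<noteq> l v" using loopless_gain_edgeD[OF \<Gamma> e] inj by (auto simp: inj_on_def)
      moreover have e': "gain_edge v u (- g) \<in> edges \<Gamma>" using e by (simp add: gain_edge_swap)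
      ultimately have "gain_vec (l v) (l u) (- g) \<in> E" using False
        unfolding E_def gain_vectors_def by (intro insertI2) (auto intro!: exI)
      moreover have "(x (l v) - x (l u) = - g * x 0) = (x (l u) - x (l v) = g * x 0)" for x :: "nat \<Rightarrow> 'k"
        by (metis minus_diff_eq mult_minus_left minus_minus)
      ultimately show ?thesis using b_gain[OF e'] by auto
    qed
    moreover have "{x \<in> coord_space n. x 0 = 0} \<in> b ` E"
      using hyperplane_of_unit_vec[OF n0] by (force simp: E_def gain_vectors_def b_def)
    ultimately show "gain_arrangement l \<Gamma> \<subseteq> b ` E"
      by (auto simp: gain_arrangement_def n_def)
  qed
  have cd: "codim n (coord_space n \<inter> \<Inter>(b ` S)) = coord.dim S" if "S \<subseteq> E" for S
    using that finE finite_subset En unfolding b_def by (intro codim_hyperplanes) auto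
  \<comment> \<open>Equal hyperplanes have an intersection of codimension one, so their normal
    vectors are parallel and hence equal.\<close>
  have injb: "inj_on b E"
  proof
    fix x y assume xy: "x \<in> E" "y \<in> E" "b x = b y"
    hence "coord.dim {y, x} = coord.dim {x}" using cd[of "{y, x}"] cd[of "{x}"] by simp
    hence "y \<in> coord.span {x}" by (simp add: coord_dim_insert[of "{x}"] split: if_splits)
    thus "x = y" using gain_vectors_simple[OF l \<Gamma>] xy by (auto simp: E_def)
  qed
  \<comment> \<open>Hyperplanes are ranked through their normal vectors; by \<open>cd\<close> this
    is the codimension of their intersection.\<close>
  define r where "r = (\<lambda>S. coord.dim {f \<in> E. b f \<in> S})"
  interpret R: rank_function r unfolding r_def by (rule coord_rank.rank_function_vimage[OF finE injb])
  have pre: "{f \<in> E. b f \<in> b ` S} = S" if "S \<subseteq> E" for S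
    using that injb by (auto simp: inj_on_def)
  have rb: "r (b ` S) = coord.dim S" if "S \<subseteq> E" for S using pre[OF that] by (simp add: r_def)
  let ?M = "dependence_matroid n (b ` E)"
  have indep: "indep ?M I \<longleftrightarrow> I \<subseteq> b ` E \<and> r I = card I" for I
  proof (cases "I \<subseteq> b ` E")
    case True
    then obtain S where S: "S \<subseteq> E" "I = b ` S" by (auto simp: subset_image_iff)
    moreover have "finite I" using S finE finite_subset by blast
    ultimately show ?thesis using cd[OF S(1)] rb[OF S(1)] by (auto simp: dependence_matroid_def)
  qed (simp add: dependence_matroid_def)
  have "has_chain l \<Gamma> (induced \<Gamma> {})"
    using gain_class_has_chain[OF assms(3,2) l] by (simp add: gain_full_def)
  moreover have "gain_vectors l (induced \<Gamma> {}) = {unit_vec 0}"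
    by (simp add: gain_vectors_def induced_def)
  ultimately obtain F m where F: "coord_rank.divisional_chain E {unit_vec 0} F m"
    by (auto simp: has_chain_def E_def)
  have z: "unit_vec 0 \<in> E" by (simp add: E_def gain_vectors_def)
  have "R.divisional_chain (b ` E) {b (unit_vec 0)} (\<lambda>i. b ` F i) m"
    using coord_rank.divisional_chain_image[OF R.rank_function_axioms injb rb _ F] z by simp
  from R.divisional_flag_of_chain[OF _ _ indep _ this] finE z
  have "divisional_flag ?M (\<lambda>i. if i \<le> m then b ` F i else b ` E)"
    by (simp add: dependence_matroid_def)
  thus ?thesis unfolding divisionally_free_def A n_def by blast
qed

end
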